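(* Let $\alpha\in\mathbb{C}$ and let $\mathrm{Der}_{ext}S'(2,\alpha)$ be the Lie superalgebra of exterior derivations of $S'(2,\alpha)$. 1) If $\alpha\in\mathbb{Z}$, then $\mathrm{Der}_{ext}S'(2,\alpha)\cong\mathfrak{sl}(2)=\langle\mathcal{E},\mathcal{H},\mathcal{F}\rangle$, where $[\mathcal{H},\mathcal{E}]=2\mathcal{E}$, $[\mathcal{H},\mathcal{F}]=-2\mathcal{F}$, $[\mathcal{E},\mathcal{F}]=\mathcal{H}$, and the action of $\mathcal{E},\mathcal{H},\mathcal{F}$ on $S'(2,\alpha)$ is given on basis elements (for all $k\in\mathbb{Z}$, all actions not listed being zero) by $$[\mathcal{E},h_k^{\alpha}]=x_{k-1+\alpha},\quad[\mathcal{E},y_k^{\alpha}]=p_{k-1+\alpha},\quad[\mathcal{F},x_k]=h^{\alpha}_{k+1-\alpha},\quad[\mathcal{F},p_k]=y^{\alpha}_{k+1-\alpha},$$ $$[\mathcal{H},x_k]=x_k,\quad[\mathcal{H},h_k^{\alpha}]=-h_k^{\alpha},\quad[\mathcal{H},p_k]=p_k,\quad[\mathcal{H},y_k^{\alpha}]=-y_k^{\alpha}.$$ 2) If $\alpha\in\mathbb{C}\setminus\mathbb{Z}$, then $\mathrm{Der}_{ext}S'(2,\alpha)=\langle\mathcal{H}\rangle$, with $\mathcal{H}$ acting by the same formulas as in 1).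
   Context: Let $W(2)$ be the Lie superalgebra of all derivations of $\mathbb{C}[t,t^{-1}]\otimes\Lambda(2)$, where $\Lambda(2)$ is the Grassmann algebra in odd variables $\theta_1,\theta_2$ and $t$ is even; $\partial_t=\partial/\partial t$, $\partial_i=\partial/\partial\theta_i$. Put $\mathrm{Div}(f\partial_t+f_1\partial_1+f_2\partial_2)=\partial_tf+\sum_{i}(-1)^{p(f_i)}\partial_if_i$ and, for $\alpha\in\mathbb{C}$, $S(2,\alpha)=\{D\in W(2)\mid \mathrm{Div}(t^{\alpha}D)=0\}$, where $\mathrm{Div}(t^\alpha D)$ is understood through $\mathrm{Div}(fD)=Df+f\,\mathrm{Div}D$ for even $f$. Let $S'(2,\alpha)=[S(2,\alpha),S(2,\alpha)]$ be the derived superalgebra. A basis of $S'(2,\alpha)$ is given by ($n\in\mathbb{Z}$): $\mathcal{L}_n^{\alpha}=-t^n(t\partial_t+\frac12(n+\alpha+1)(\theta_1\partial_1+\theta_2\partial_2))$, $E_n=t^n\theta_2\partial_1$, $H_n=t^n(\theta_2\partial_2-\theta_1\partial_1)$, $F_n=t^n\theta_1\partial_2$, $h_n^{\alpha}=t^n\theta_2\partial_t-(n+\alpha)t^{n-1}\theta_1\theta_2\partial_1$, $p_n=-t^{n+1}\partial_2$, $x_n=t^{n+1}\partial_1$, $y_n^{\alpha}=t^n\theta_1\partial_t+(n+\alpha)t^{n-1}\theta_1\theta_2\partial_2$. $\mathrm{Der}\,S'(2,\alpha)$ is the Lie superalgebra of all derivations of $S'(2,\alpha)$. The exterior derivations $\mathrm{Der}_{ext}S'(2,\alpha)$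 are the quotient of $\mathrm{Der}\,S'(2,\alpha)$ by the inner derivations, i.e. $H^1(S'(2,\alpha),S'(2,\alpha))$ (adjoint coefficients). The displayed formulas describe derivations representing the classes $\mathcal{E},\mathcal{H},\mathcal{F}$, with $[D,s]$ denoting the value of the derivation $D$ at $s$. *)

theory Defs
  imports "HOL-Analysis.Determinants" "HOL-Library.Poly_Mapping" "HOL-Library.Z2"
    "HOL-Library.FuncSet"
begin

section \<open>Superalgebras, superderivations, exterior derivations\<close>

text \<open>
  A (not necessarily associative) superalgebra over the complex numbers, given on a carrier set.
  The grading is recorded by the two projections \<open>spart A 0\<close> (even part) and \<open>spart A 1\<close> (odd part).
  For a Lie superalgebra the product \<open>sprod\<close> is the superbracket.
\<close>

record 'a superalgebra =
  scarrier :: "'a set"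
  szero :: 'a
  splus :: "'a \<Rightarrow> 'a \<Rightarrow> 'a"
  sscale :: "complex \<Rightarrow> 'a \<Rightarrow> 'a"
  sprod :: "'a \<Rightarrow> 'a \<Rightarrow> 'a"
  spart :: "bit \<Rightarrow> 'a \<Rightarrow> 'a"

definition homogeneous :: "('a, 'm) superalgebra_scheme \<Rightarrow> bit \<Rightarrow> 'a set" where
  "homogeneous A p = {x \<in> scarrier A. spart A p x = x}"

definition ssubspace :: "('a, 'm) superalgebra_scheme \<Rightarrow> 'a set \<Rightarrow> bool" where
  "ssubspace A V \<longleftrightarrow> V \<subseteq> scarrier A \<and> szero A \<in> V \<and>
     (\<forall>x\<in>V. \<forall>y\<in>V. splus A x y \<in> V) \<and> (\<forall>c. \<forall>x\<in>V. sscale A c x \<in> V)"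

definition sspan :: "('a, 'm) superalgebra_scheme \<Rightarrow> 'a set \<Rightarrow> 'a set" where
  "sspan A X = \<Inter> {V. ssubspace A V \<and> X \<subseteq> V}"

definition derived :: "('a, 'm) superalgebra_scheme \<Rightarrow> ('a, 'm) superalgebra_scheme" where
  "derived L = L\<lparr>scarrier := sspan L {sprod L x y | x y. x \<in> scarrier L \<and> y \<in> scarrier L}\<rparr>"

definition koszul :: "bit \<Rightarrow> bit \<Rightarrow> complex" where
  "koszul p q = (if p = 1 \<and> q = 1 then - 1 else 1)"

text \<open>
  Superderivations of parity \<open>p\<close>: \<open>D(xy) = D(x)y + (-1)\<^bsup>p q\<^esup> x D(y)\<close> for \<open>x\<close> of parity \<open>q\<close>.
  Maps are taken to be \<open>undefined\<close> outside of the carrier, so that they are determined by their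
  values on the carrier.
\<close>

definition superder :: "('a, 'm) superalgebra_scheme \<Rightarrow> bit \<Rightarrow> ('a \<Rightarrow> 'a) set" where
  "superder A p = {D \<in> scarrier A \<rightarrow>\<^sub>E scarrier A.
     (\<forall>x\<in>scarrier A. \<forall>y\<in>scarrier A. D (splus A x y) = splus A (D x) (D y)) \<and>
     (\<forall>c. \<forall>x\<in>scarrier A. D (sscale A c x) = sscale A c (D x)) \<and>
     (\<forall>q. \<forall>x\<in>homogeneous A q. D x \<in> homogeneous A (p + q)) \<and>
     (\<forall>q. \<forall>x\<in>homogeneous A q. \<forall>y\<in>scarrier A.
        D (sprod A x y) = splus A (sprod A (D x) y) (sscale A (koszul p q) (sprod A x (D y))))}"

definition op_plus :: "('a, 'm) superalgebra_scheme \<Rightarrow> ('a \<Rightarrow> 'a) \<Rightarrow> ('a \<Rightarrow> 'a) \<Rightarrow> 'a \<Rightarrow> 'a" where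
  "op_plus A D D' = (\<lambda>x\<in>scarrier A. splus A (D x) (D' x))"

definition op_scale :: "('a, 'm) superalgebra_scheme \<Rightarrow> complex \<Rightarrow> ('a \<Rightarrow> 'a) \<Rightarrow> 'a \<Rightarrow> 'a" where
  "op_scale A c D = (\<lambda>x\<in>scarrier A. sscale A c (D x))"

definition op_comp :: "('a, 'm) superalgebra_scheme \<Rightarrow> ('a \<Rightarrow> 'a) \<Rightarrow> ('a \<Rightarrow> 'a) \<Rightarrow> 'a \<Rightarrow> 'a" where
  "op_comp A D D' = (\<lambda>x\<in>scarrier A. D (D' x))"

text \<open>The component of parity \<open>p\<close> of a linear map: it sends the part of parity \<open>q\<close> to parity \<open>p + q\<close>.\<close>

definition op_part :: "('a, 'm) superalgebra_scheme \<Rightarrow> bit \<Rightarrow> ('a \<Rightarrow> 'a) \<Rightarrow> 'a \<Rightarrow> 'a" where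
  "op_part A p D = (\<lambda>x\<in>scarrier A.
     splus A (spart A p (D (spart A 0 x))) (spart A (p + 1) (D (spart A 1 x))))"

text \<open>
  The supercommutator \<open>[D, D'] = D D' - \<Sum>\<^bsub>p,q\<^esub> (-1)\<^bsup>p q\<^esup> D'\<^sub>q D\<^sub>p\<close>, i.e. the bilinear extension of
  \<open>D D' - (-1)\<^bsup>p q\<^esup> D' D\<close> for \<open>D\<close>, \<open>D'\<close> of parity \<open>p\<close>, \<open>q\<close>.
\<close>

definition supercomm :: "('a, 'm) superalgebra_scheme \<Rightarrow> ('a \<Rightarrow> 'a) \<Rightarrow> ('a \<Rightarrow> 'a) \<Rightarrow> 'a \<Rightarrow> 'a" where
  "supercomm A D D' =
     (let term = (\<lambda>p q. op_scale A (- koszul p q) (op_comp A (op_part A q D') (op_part A p D)))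
      in op_plus A (op_comp A D D')
           (op_plus A (op_plus A (term 0 0) (term 0 1)) (op_plus A (term 1 0) (term 1 1))))"

definition Der :: "('a, 'm) superalgebra_scheme \<Rightarrow> ('a \<Rightarrow> 'a) superalgebra" where
  "Der A = \<lparr>
     scarrier = {op_plus A D0 D1 | D0 D1. D0 \<in> superder A 0 \<and> D1 \<in> superder A 1},
     szero = (\<lambda>x\<in>scarrier A. szero A),
     splus = op_plus A,
     sscale = op_scale A,
     sprod = supercomm A,
     spart = op_part A\<rparr>"

definition inner_der :: "('a, 'm) superalgebra_scheme \<Rightarrow> 'a \<Rightarrow> 'a \<Rightarrow> 'a" where
  "inner_der L x = (\<lambda>y\<in>scarrier L. sprod L x y)"

definition Inn :: "('a, 'm) superalgebra_scheme \<Rightarrow> ('a \<Rightarrow> 'a) set" where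
  "Inn L = inner_der L ` scarrier L"

definition coset :: "('a, 'm) superalgebra_scheme \<Rightarrow> 'a set \<Rightarrow> 'a \<Rightarrow> 'a set" where
  "coset L I x = (\<lambda>i. splus L x i) ` I"

definition quotient :: "('a, 'm) superalgebra_scheme \<Rightarrow> 'a set \<Rightarrow> 'a set superalgebra" where
  "quotient L I = \<lparr>
     scarrier = coset L I ` scarrier L,
     szero = coset L I (szero L),
     splus = (\<lambda>X Y. \<Union>x\<in>X. \<Union>y\<in>Y. coset L I (splus L x y)),
     sscale = (\<lambda>c X. \<Union>x\<in>X. coset L I (sscale L c x)),
     sprod = (\<lambda>X Y. \<Union>x\<in>X. \<Union>y\<in>Y. coset L I (sprod L x y)),
     spart = (\<lambda>p X. \<Union>x\<in>X. coset L I (spart L p x))\<rparr>"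

definition Der_ext :: "('a, 'm) superalgebra_scheme \<Rightarrow> ('a \<Rightarrow> 'a) set superalgebra" where
  "Der_ext L = quotient (Der L) (Inn L)"

definition ext_class :: "('a, 'm) superalgebra_scheme \<Rightarrow> ('a \<Rightarrow> 'a) \<Rightarrow> ('a \<Rightarrow> 'a) set" where
  "ext_class L D = coset (Der L) (Inn L) D"

definition superalgebra_iso ::
    "('a, 'm) superalgebra_scheme \<Rightarrow> ('b, 'n) superalgebra_scheme \<Rightarrow> ('a \<Rightarrow> 'b) set" where
  "superalgebra_iso L M = {\<phi>. bij_betw \<phi> (scarrier L) (scarrier M) \<and>
     (\<forall>x\<in>scarrier L. \<forall>y\<in>scarrier L. \<phi> (splus L x y) = splus M (\<phi> x) (\<phi> y)) \<and>
     (\<forall>c. \<forall>x\<in>scarrier L. \<phi> (sscale L c x) = sscale M c (\<phi> x)) \<and>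
     (\<forall>x\<in>scarrier L. \<forall>y\<in>scarrier L. \<phi> (sprod L x y) = sprod M (\<phi> x) (\<phi> y)) \<and>
     (\<forall>p. \<forall>x\<in>scarrier L. \<phi> (spart L p x) = spart M p (\<phi> x))}"

section \<open>The Lie algebra sl(2), regarded as a purely even Lie superalgebra\<close>

definition sl2 :: "(complex^2^2) superalgebra" where
  "sl2 = \<lparr>
     scarrier = {X. trace X = 0},
     szero = 0,
     splus = (+),
     sscale = (\<lambda>c X. \<chi> i j. c * X $ i $ j),
     sprod = (\<lambda>X Y. X ** Y - Y ** X),
     spart = (\<lambda>p X. if p = 0 then X else 0)\<rparr>"

definition sl2_e :: "complex^2^2" where "sl2_e = vector [vector [0, 1], vector [0, 0]]"
definition sl2_h :: "complex^2^2" where "sl2_h = vector [vector [1, 0], vector [0, - 1]]"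
definition sl2_f :: "complex^2^2" where "sl2_f = vector [vector [0, 0], vector [1, 0]]"

section \<open>The algebra of Laurent polynomials tensored with the Grassmann algebra in two variables\<close>

text \<open>\<open>Gr a b c d\<close> stands for \<open>a + b \<theta>\<^sub>1 + c \<theta>\<^sub>2 + d \<theta>\<^sub>1\<theta>\<^sub>2\<close> with coefficients in a commutative ring.\<close>

datatype 'a grassmann2 = Gr (gr0: 'a) (gr1: 'a) (gr2: 'a) (gr12: 'a)

instantiation grassmann2 :: (comm_ring_1) ring_1
begin

definition "0 = Gr 0 0 0 0"
definition "1 = Gr 1 0 0 0"
definition "x + y = Gr (gr0 x + gr0 y) (gr1 x + gr1 y) (gr2 x + gr2 y) (gr12 x + gr12 y)"
definition "x - y = Gr (gr0 x - gr0 y) (gr1 x - gr1 y) (gr2 x - gr2 y) (gr12 x - gr12 y)"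
definition "- x = Gr (- gr0 x) (- gr1 x) (- gr2 x) (- gr12 x)"
definition "x * y = Gr
  (gr0 x * gr0 y)
  (gr0 x * gr1 y + gr1 x * gr0 y)
  (gr0 x * gr2 y + gr2 x * gr0 y)
  (gr0 x * gr12 y + gr1 x * gr2 y - gr2 x * gr1 y + gr12 x * gr0 y)"

instance
  by standard
    (auto simp: zero_grassmann2_def one_grassmann2_def plus_grassmann2_def minus_grassmann2_def
      uminus_grassmann2_def times_grassmann2_def algebra_simps)

end

text \<open>The group ring of the integers, whose element \<open>single n c\<close> is \<open>c t\<^sup>n\<close>.\<close>

type_synonym laurent = "int \<Rightarrow>\<^sub>0 complex"

type_synonym sfun = "laurent grassmann2"

definition cst :: "complex \<Rightarrow> sfun" where "cst c = Gr (Poly_Mapping.single 0 c) 0 0 0"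
definition t_pow :: "int \<Rightarrow> sfun" where "t_pow n = Gr (Poly_Mapping.single n 1) 0 0 0"
definition theta1 :: sfun where "theta1 = Gr 0 1 0 0"
definition theta2 :: sfun where "theta2 = Gr 0 0 1 0"

definition laurent_deriv :: "laurent \<Rightarrow> laurent" where
  "laurent_deriv f =
     (\<Sum>n\<in>Poly_Mapping.keys f. Poly_Mapping.single (n - 1) (of_int n * Poly_Mapping.lookup f n))"

definition d_t :: "sfun \<Rightarrow> sfun" where "d_t = map_grassmann2 laurent_deriv"

text \<open>Left derivatives, so that \<open>\<partial>\<^sub>2(\<theta>\<^sub>1\<theta>\<^sub>2) = -\<theta>\<^sub>1\<close>.\<close>

definition d_1 :: "sfun \<Rightarrow> sfun" where "d_1 a = Gr (gr1 a) 0 (gr12 a) 0"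
definition d_2 :: "sfun \<Rightarrow> sfun" where "d_2 a = Gr (gr2 a) (- gr12 a) 0 0"

definition sfun_part :: "bit \<Rightarrow> sfun \<Rightarrow> sfun" where
  "sfun_part p a = (if p = 0 then Gr (gr0 a) 0 0 (gr12 a) else Gr 0 (gr1 a) (gr2 a) 0)"

definition sfun_algebra :: "sfun superalgebra" where
  "sfun_algebra = \<lparr>
     scarrier = UNIV,
     szero = 0,
     splus = (+),
     sscale = (\<lambda>c a. cst c * a),
     sprod = (*),
     spart = sfun_part\<rparr>"

section \<open>The Lie superalgebras W(2), S(2,\<alpha>) and S'(2,\<alpha>)\<close>

definition W2 :: "(sfun \<Rightarrow> sfun) superalgebra" where
  "W2 = Der sfun_algebra"

definition vector_field :: "sfun \<Rightarrow> sfun \<Rightarrow> sfun \<Rightarrow> sfun \<Rightarrow> sfun" where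
  "vector_field f f1 f2 = (\<lambda>a. f * d_t a + f1 * d_1 a + f2 * d_2 a)"

text \<open>
  The coefficients of \<open>D = f \<partial>\<^sub>t + f\<^sub>1 \<partial>\<^sub>1 + f\<^sub>2 \<partial>\<^sub>2\<close> are \<open>f = D(t)\<close> and \<open>f\<^sub>i = D(\<theta>\<^sub>i)\<close>; the sign
  \<open>(-1)\<^bsup>p(f\<^sub>i)\<^esup>\<close> is extended linearly to inhomogeneous coefficients.
\<close>

definition parity_sign :: "sfun \<Rightarrow> sfun" where
  "parity_sign a = sfun_part 0 a - sfun_part 1 a"

definition Div :: "(sfun \<Rightarrow> sfun) \<Rightarrow> sfun" where
  "Div D = d_t (D (t_pow 1)) + d_1 (parity_sign (D theta1)) + d_2 (parity_sign (D theta2))"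

text \<open>
  \<open>Div(t\<^sup>\<alpha> D) = D(t\<^sup>\<alpha>) + t\<^sup>\<alpha> Div D\<close> with \<open>D(t\<^sup>\<alpha>) = \<alpha> t\<^bsup>\<alpha>-1\<^esup> D(t)\<close>, so
  \<open>Div(t\<^sup>\<alpha> D) = t\<^sup>\<alpha> twisted_div \<alpha> D\<close>, where only \<open>twisted_div \<alpha> D\<close> has integral exponents.
\<close>

definition twisted_div :: "complex \<Rightarrow> (sfun \<Rightarrow> sfun) \<Rightarrow> sfun" where
  "twisted_div \<alpha> D = cst \<alpha> * t_pow (- 1) * D (t_pow 1) + Div D"

definition S2 :: "complex \<Rightarrow> (sfun \<Rightarrow> sfun) superalgebra" where
  "S2 \<alpha> = W2\<lparr>scarrier := {D \<in> scarrier W2. twisted_div \<alpha> D = 0}\<rparr>"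

definition S2' :: "complex \<Rightarrow> (sfun \<Rightarrow> sfun) superalgebra" where
  "S2' \<alpha> = derived (S2 \<alpha>)"

text \<open>The basis elements \<open>\<L>\<^sub>n\<^sup>\<alpha>, E\<^sub>n, H\<^sub>n, F\<^sub>n\<close> (even) and \<open>h\<^sub>n\<^sup>\<alpha>, p\<^sub>n, x\<^sub>n, y\<^sub>n\<^sup>\<alpha>\<close> (odd) of S'(2,\<alpha>).\<close>

definition bas_L :: "complex \<Rightarrow> int \<Rightarrow> sfun \<Rightarrow> sfun" where
  "bas_L \<alpha> n = vector_field (- t_pow (n + 1))
     (- (cst ((of_int n + \<alpha> + 1) / 2) * t_pow n * theta1))
     (- (cst ((of_int n + \<alpha> + 1) / 2) * t_pow n * theta2))"

definition bas_E :: "int \<Rightarrow> sfun \<Rightarrow> sfun" where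
  "bas_E n = vector_field 0 (t_pow n * theta2) 0"

definition bas_H :: "int \<Rightarrow> sfun \<Rightarrow> sfun" where
  "bas_H n = vector_field 0 (- (t_pow n * theta1)) (t_pow n * theta2)"

definition bas_F :: "int \<Rightarrow> sfun \<Rightarrow> sfun" where
  "bas_F n = vector_field 0 0 (t_pow n * theta1)"

definition bas_h :: "complex \<Rightarrow> int \<Rightarrow> sfun \<Rightarrow> sfun" where
  "bas_h \<alpha> n = vector_field (t_pow n * theta2)
     (- (cst (of_int n + \<alpha>) * t_pow (n - 1) * theta1 * theta2)) 0"

definition bas_p :: "int \<Rightarrow> sfun \<Rightarrow> sfun" where
  "bas_p n = vector_field 0 0 (- t_pow (n + 1))"

definition bas_x :: "int \<Rightarrow> sfun \<Rightarrow> sfun" where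
  "bas_x n = vector_field 0 (t_pow (n + 1)) 0"

definition bas_y :: "complex \<Rightarrow> int \<Rightarrow> sfun \<Rightarrow> sfun" where
  "bas_y \<alpha> n = vector_field (t_pow n * theta1) 0
     (cst (of_int n + \<alpha>) * t_pow (n - 1) * theta1 * theta2)"

section \<open>The actions of \<open>\<E>\<close>, \<open>\<H>\<close> and \<open>\<F>\<close> on the basis of S'(2,\<alpha>)\<close>

text \<open>Here \<open>a\<close> is the integer \<open>\<alpha>\<close>.\<close>

definition acts_as_E :: "int \<Rightarrow> ((sfun \<Rightarrow> sfun) \<Rightarrow> (sfun \<Rightarrow> sfun)) \<Rightarrow> bool" where
  "acts_as_E a D \<longleftrightarrow> (let \<alpha> = complex_of_int a; z = szero (S2' \<alpha>) in \<forall>k.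
     D (bas_L \<alpha> k) = z \<and> D (bas_E k) = z \<and> D (bas_H k) = z \<and> D (bas_F k) = z \<and>
     D (bas_h \<alpha> k) = bas_x (k - 1 + a) \<and> D (bas_y \<alpha> k) = bas_p (k - 1 + a) \<and>
     D (bas_x k) = z \<and> D (bas_p k) = z)"

definition acts_as_F :: "int \<Rightarrow> ((sfun \<Rightarrow> sfun) \<Rightarrow> (sfun \<Rightarrow> sfun)) \<Rightarrow> bool" where
  "acts_as_F a D \<longleftrightarrow> (let \<alpha> = complex_of_int a; z = szero (S2' \<alpha>) in \<forall>k.
     D (bas_L \<alpha> k) = z \<and> D (bas_E k) = z \<and> D (bas_H k) = z \<and> D (bas_F k) = z \<and>
     D (bas_x k) = bas_h \<alpha> (k + 1 - a) \<and> D (bas_p k) = bas_y \<alpha> (k + 1 - a) \<and>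
     D (bas_h \<alpha> k) = z \<and> D (bas_y \<alpha> k) = z)"

definition acts_as_H :: "complex \<Rightarrow> ((sfun \<Rightarrow> sfun) \<Rightarrow> (sfun \<Rightarrow> sfun)) \<Rightarrow> bool" where
  "acts_as_H \<alpha> D \<longleftrightarrow> (let z = szero (S2' \<alpha>) in \<forall>k.
     D (bas_L \<alpha> k) = z \<and> D (bas_E k) = z \<and> D (bas_H k) = z \<and> D (bas_F k) = z \<and>
     D (bas_x k) = bas_x k \<and> D (bas_h \<alpha> k) = sscale (S2' \<alpha>) (- 1) (bas_h \<alpha> k) \<and>
     D (bas_p k) = bas_p k \<and> D (bas_y \<alpha> k) = sscale (S2' \<alpha>) (- 1) (bas_y \<alpha> k))"

end

theory Submission
  imports Defs "HOL-Library.Function_Algebras"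
begin

text \<open>
  A field in \<open>S'(2,\<alpha>)\<close> is described by eight Laurent polynomials, one for each family of basis
  elements, and in these coordinates the superbracket is an explicit bidifferential operator.
  For \<open>\<alpha> \<in> \<int>\<close> multiplication by \<open>t\<^sup>\<alpha>\<close> identifies the two odd doublets \<open>(x, p)\<close> and \<open>(h, y)\<close>, and
  traceless matrices acting on this pair of doublets are outer derivations.

  Conversely, let \<open>D\<close> be a derivation. An element \<open>T = \<L>\<^sub>0 + c H\<^sub>0\<close> acts diagonally on the basis, so
  subtracting an inner derivation achieves \<open>D T = 0\<close>, and then \<open>D\<close> preserves the eigenspaces of \<open>T\<close>.
  If the imaginary part of \<open>c\<close> is large, the even and odd eigenvalues are disjoint, so odd derivations
  are inner; for even \<open>D\<close> the eigenspaces are at most two-dimensional, and the Leibniz rule on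
  \<open>\<L>\<close>, \<open>E\<close>, \<open>H\<close>, \<open>F\<close> leaves only combinations of \<open>\<L>\<^sub>0\<close>, \<open>H\<^sub>0\<close> on the even part. After removing these,
  \<open>D\<close> is determined by its values on one element of each odd doublet, and \<open>[x, y]\<close> being killed forces
  the resulting matrix to be traceless.
\<close>

section \<open>Laurent polynomials\<close>

lemma lookup_laurent_deriv:
  "Poly_Mapping.lookup (laurent_deriv f) n = of_int (n + 1) * Poly_Mapping.lookup f (n + 1)"
proof -
  have "Poly_Mapping.lookup (laurent_deriv f) n =
      (\<Sum>k\<in>Poly_Mapping.keys f. if k = n + 1 then of_int k * Poly_Mapping.lookup f k else 0)"
    unfolding laurent_deriv_def lookup_sum
    by (rule sum.cong) (auto simp: lookup_single when_def)
  then show ?thesis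
    by (simp add: sum.delta' in_keys_iff)
qed

lemma laurent_deriv_add [simp]: "laurent_deriv (f + g) = laurent_deriv f + laurent_deriv g"
  by (rule poly_mapping_eqI) (simp add: lookup_laurent_deriv lookup_add algebra_simps)

lemma laurent_deriv_uminus [simp]: "laurent_deriv (- f) = - laurent_deriv f"
  by (rule poly_mapping_eqI) (simp add: lookup_laurent_deriv)

lemma laurent_deriv_diff [simp]: "laurent_deriv (f - g) = laurent_deriv f - laurent_deriv g"
  by (rule poly_mapping_eqI) (simp add: lookup_laurent_deriv lookup_minus algebra_simps)

lemma laurent_deriv_single [simp]:
  "laurent_deriv (Poly_Mapping.single n c) = Poly_Mapping.single (n - 1) (of_int n * c)"
  by (rule poly_mapping_eqI) (auto simp: lookup_laurent_deriv lookup_single when_def)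

lemma laurent_deriv_0 [simp]: "laurent_deriv 0 = 0"
  by (rule poly_mapping_eqI) (simp add: lookup_laurent_deriv)

lemma laurent_deriv_1 [simp]: "laurent_deriv 1 = 0"
  by (simp flip: single_one)

text \<open>Monomials span the Laurent polynomials additively, so an additive statement needs
  checking on them only; zero is the monomial with coefficient 0.\<close>

lemma laurent_induct [case_names single add]:
  fixes f :: laurent
  assumes "\<And>n c. P (Poly_Mapping.single n c)"
    and "\<And>f g. P f \<Longrightarrow> P g \<Longrightarrow> P (f + g)"
  shows "P f"
proof (induction f rule: update_induct)
  case const
  show ?case using assms(1)[of 0 0] by simp
next
  case (update f k v)
  have "Poly_Mapping.update k v f = f + Poly_Mapping.single k v"
    using update.hyps
    by (intro poly_mapping_eqI) (auto simp: lookup_update lookup_add lookup_single in_keys_iff)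
  with update.IH assms show ?case by simp
qed

lemma laurent_deriv_mult [simp]:
  "laurent_deriv (f * g) = laurent_deriv f * g + f * laurent_deriv g"
proof (induction f rule: laurent_induct)
  case (single n c)
  then show ?case
  proof (induction g rule: laurent_induct)
    case (single m d)
    then show ?case
      by (simp add: mult_single algebra_simps flip: single_add)
  next
    case (add f g)
    then show ?case by (simp add: algebra_simps)
  qed
next
  case (add f g)
  then show ?case by (simp add: algebra_simps)
qed

lemma lookup_single_mult:
  fixes f :: laurent
  shows "Poly_Mapping.lookup (Poly_Mapping.single n c * f) m = c * Poly_Mapping.lookup f (m - n)"
proof (induction f rule: laurent_induct)
  case (single k d)
  then show ?case by (auto simp: mult_single lookup_single when_def)
next
  case (add f g)
  then show ?case by (simp add: algebra_simps lookup_add)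
qed

abbreviation const :: "complex \<Rightarrow> laurent" where
  "const c \<equiv> Poly_Mapping.single 0 c"

text \<open>Laurent polynomials form a ring without division. Kept folded, \<open>half\<close> is an
  atom for ring normalisation and is cancelled by explicit rules.\<close>

definition half :: laurent where "half = const (1/2)"

lemma laurent_deriv_half [simp]: "laurent_deriv half = 0"
  by (simp add: half_def)

lemma half_double: "2 * half = 1" "2 * (half * f) = f" "half * (2 * f) = f"
proof -
  have "half + half = 1"
    by (simp add: half_def flip: single_add)
  then show 1: "2 * half = 1" unfolding mult_2 .
  show "2 * (half * f) = f" by (simp add: 1 flip: mult.assoc)
  show "half * (2 * f) = f" by (metis 1 mult.commute mult.assoc mult_1)
qed

lemma laurent_double_cancel: "2 * f = 2 * g \<Longrightarrow> f = g" for f g :: laurent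
  by (metis half_double(3))

section \<open>Vector fields\<close>

lemmas gr_defs = zero_grassmann2_def one_grassmann2_def plus_grassmann2_def minus_grassmann2_def
  uminus_grassmann2_def times_grassmann2_def

lemma sfun_algebra_simps [simp]:
  "scarrier sfun_algebra = UNIV" "szero sfun_algebra = 0" "splus sfun_algebra = (+)"
  "sscale sfun_algebra = (\<lambda>c a. cst c * a)" "sprod sfun_algebra = (*)"
  "spart sfun_algebra = sfun_part"
  by (simp_all add: sfun_algebra_def)

lemma bit_cases: "p = (0::bit) \<or> p = 1"
  by (cases p) auto

text \<open>As \<partial>_1 and \<partial>_2 are odd, their coefficients have the parity opposite to
  that of the field. All conditions are verified on the four Grassmann components, parity by
  parity.\<close>

lemma superder_vector_field:
  assumes "sfun_part p f = f" "sfun_part (p + 1) f1 = f1" "sfun_part (p + 1) f2 = f2"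
  shows "vector_field f f1 f2 \<in> superder sfun_algebra p"
proof -
  have add: "vector_field f f1 f2 (x + y) = vector_field f f1 f2 x + vector_field f f1 f2 y" for x y
    by (cases x; cases y) (simp add: vector_field_def d_t_def d_1_def d_2_def gr_defs algebra_simps)
  have scale: "vector_field f f1 f2 (cst c * x) = cst c * vector_field f f1 f2 x" for c x
    by (cases x) (simp add: vector_field_def d_t_def d_1_def d_2_def cst_def gr_defs algebra_simps)
  have part: "sfun_part (p + q) (vector_field f f1 f2 x) = vector_field f f1 f2 x"
    if "sfun_part q x = x" for q x
    using assms that bit_cases[of p] bit_cases[of q]
    by (cases x; cases f; cases f1; cases f2)
      (auto simp: vector_field_def d_t_def d_1_def d_2_def sfun_part_def gr_defs)
  have leib: "vector_field f f1 f2 (x * y) =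
     vector_field f f1 f2 x * y + cst (koszul p q) * (x * vector_field f f1 f2 y)"
    if "sfun_part q x = x" for q x y
    using assms that bit_cases[of p] bit_cases[of q]
    by (cases x; cases y; cases f; cases f1; cases f2)
      (auto simp: vector_field_def d_t_def d_1_def d_2_def sfun_part_def koszul_def cst_def gr_defs
       single_uminus algebra_simps)
  show ?thesis
    using add scale part leib by (auto simp: superder_def homogeneous_def PiE_def)
qed

text \<open>The function algebra is generated by t, its inverse, \<theta>_1 and \<theta>_2, and the
  Leibniz rule forces the value on the inverse of t. So a derivation is known from its values on t,
  \<theta>_1 and \<theta>_2.\<close>

lemma superder_eq_vector_field:
  assumes D: "D \<in> superder sfun_algebra p"
  shows "D = vector_field (D (t_pow 1)) (D theta1) (D theta2)"
    and "sfun_part p (D (t_pow 1)) = D (t_pow 1)"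
    and "sfun_part (p + 1) (D theta1) = D theta1"
    and "sfun_part (p + 1) (D theta2) = D theta2"
proof -
  define emb :: "laurent \<Rightarrow> sfun" where "emb g = Gr g 0 0 0" for g
  have add: "D (x + y) = D x + D y" for x y
    using D by (auto simp: superder_def)
  have scale: "D (cst c * x) = cst c * D x" for c x
    using D by (auto simp: superder_def)
  have part: "sfun_part (p + q) (D x) = D x" if "sfun_part q x = x" for q x
    using D that by (auto simp: superder_def homogeneous_def)
  have leib: "D (x * y) = D x * y + cst (koszul p q) * (x * D y)"
    if "sfun_part q x = x" for q x y
    using D that unfolding superder_def by (auto simp: homogeneous_def)
  have cst1: "cst 1 = 1" by (simp add: cst_def gr_defs)
  have par: "sfun_part 0 (emb g) = emb g" "sfun_part 1 (emb g * theta1) = emb g * theta1"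
     "sfun_part 0 (t_pow n) = t_pow n" "sfun_part 1 theta1 = theta1" "sfun_part 1 theta2 = theta2"
     "sfun_part 0 1 = 1" for g n
    by (simp_all add: sfun_part_def emb_def theta1_def theta2_def t_pow_def gr_defs)
  show "sfun_part p (D (t_pow 1)) = D (t_pow 1)"
    and pt1: "sfun_part (p + 1) (D theta1) = D theta1"
    and pt2: "sfun_part (p + 1) (D theta2) = D theta2"
    using part[OF par(3), of 1] part[OF par(4)] part[OF par(5)] by (simp_all only: add_0_right)
  have leib0: "D (emb g * y) = D (emb g) * y + emb g * D y" for g y
    using leib[OF par(1), of g y] by (simp add: koszul_def cst1)
  have emb_mult: "emb (g * h) = emb g * emb h" for g h
    by (simp add: emb_def gr_defs)
  \<comment> \<open>D(t) may be odd, but powers of t are central, so it can always be moved to the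
    right of them.\<close>
  have emb_comm: "emb g * y = y * emb g" for g y
    by (cases y) (simp add: emb_def gr_defs mult.commute)
  define e where "e n = emb (Poly_Mapping.single n 1)" for n
  have e_add: "e (m + n) = e m * e n" for m n
    by (simp add: e_def mult_single flip: emb_mult)
  have e0: "e 0 = 1" by (simp add: e_def emb_def one_grassmann2_def)
  have e1: "e 1 = t_pow 1" by (simp add: e_def emb_def t_pow_def)
  have D1: "D 1 = 0"
    using leib0[of 1 1] by (simp add: e0 emb_def flip: one_grassmann2_def)
  have step: "D (e (n + 1)) = D (e n) * e 1 + e n * D (e 1)" for n
    unfolding e_add by (simp add: leib0 e_def)
  have inv: "e n * e (- n) = 1" for n
    by (simp add: e0 flip: e_add)
  have De: "D (e n) = of_int n * (e (n - 1) * D (e 1))" for n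
  proof (induction n rule: int_induct[where k = 0])
    case base
    then show ?case by (simp add: e0 D1)
  next
    case (step1 i)
    have "e (i - 1) * D (e 1) * e 1 = e i * D (e 1)"
    proof -
      have "e i = e (i - 1) * e 1" using e_add[of "i - 1" 1] by simp
      moreover have "D (e 1) * e 1 = e 1 * D (e 1)" by (simp only: e_def emb_comm)
      ultimately show ?thesis by (simp only: mult.assoc)
    qed
    then show ?case
      unfolding step step1 by (simp add: algebra_simps)
  next
    case (step2 i)
    have "D (e i) = D (e (i - 1)) * e 1 + e (i - 1) * D (e 1)"
      using step[of "i - 1"] by simp
    then have "D (e (i - 1)) * e 1 = (of_int i - 1) * (e (i - 1) * D (e 1))"
      unfolding step2 by (simp add: algebra_simps)
    \<comment> \<open>The Leibniz rule for t^i = t^(i-1) t, solved for the lower power, is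
      multiplied by the inverse of t.\<close>
    then have "D (e (i - 1)) * e 1 * e (- 1) = (of_int i - 1) * (e (i - 1) * D (e 1)) * e (- 1)"
      by simp
    then have "D (e (i - 1)) * (e 1 * e (- 1)) = (of_int i - 1) * ((e (i - 1) * D (e 1)) * e (- 1))"
      by (simp only: mult.assoc)
    moreover have "(e (i - 1) * D (e 1)) * e (- 1) = e (i - 1 - 1) * D (e 1)"
    proof -
      have "e (i - 1 - 1) = e (i - 1) * e (- 1)" using e_add[of "i - 1" "- 1"] by simp
      moreover have "D (e 1) * e (- 1) = e (- 1) * D (e 1)" by (simp only: e_def emb_comm)
      ultimately show ?thesis by (simp only: mult.assoc)
    qed
    ultimately show ?case by (simp only: inv of_int_diff of_int_1 mult_1_right)
  qed
  have D_emb: "D (emb g) = emb (laurent_deriv g) * D (e 1)" for g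
  proof (induction g rule: laurent_induct)
    case (single n c)
    have "emb (Poly_Mapping.single n c) = cst c * e n"
      by (simp add: emb_def e_def cst_def gr_defs mult_single)
    moreover have "emb (laurent_deriv (Poly_Mapping.single n c)) = cst c * (of_int n * e (n - 1))"
    proof -
      have "(of_int n :: sfun) = emb (const (of_int n))"
        by (induction n rule: int_induct[where k = 0])
          (simp_all add: emb_def gr_defs single_add single_diff)
      then show ?thesis
        by (simp add: emb_def e_def cst_def gr_defs mult_single mult.commute single_of_int[symmetric] del: single_of_int)
    qed
    ultimately show ?case
      by (simp add: scale De[of n] mult.assoc)
  next
    case (add f g)
    have "emb (f + g) = emb f + emb g" for f g by (simp add: emb_def gr_defs)
    then show ?case using add by (simp add: \<open>\<And>x y. D (x + y) = D x + D y\<close> algebra_simps)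
  qed
  show "D = vector_field (D (t_pow 1)) (D theta1) (D theta2)"
  proof
    fix a :: sfun
    obtain a0 a1 a2 a3 where a: "a = Gr a0 a1 a2 a3" by (cases a)
    have a': "a = emb a0 + emb a1 * theta1 + emb a2 * theta2 + (emb a3 * theta1) * theta2"
      by (simp add: a emb_def theta1_def theta2_def gr_defs)
    \<comment> \<open>Only the last product carries a Koszul sign: there D passes the odd factor
      \<open>emb a3 * theta1\<close>.\<close>
    have "D a = D (emb a0) + (D (emb a1) * theta1 + emb a1 * D theta1)
       + (D (emb a2) * theta2 + emb a2 * D theta2)
       + ((D (emb a3) * theta1 + emb a3 * D theta1) * theta2
          + cst (koszul p 1) * (emb a3 * theta1 * D theta2))"
      unfolding a' add leib0 leib[OF par(2)] ..
    also have "\<dots> = vector_field (D (t_pow 1)) (D theta1) (D theta2) a"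
      unfolding D_emb e1 using bit_cases[of p] pt1 pt2
      by (cases "D (t_pow 1)"; cases "D theta1"; cases "D theta2")
        (auto simp: a vector_field_def d_t_def d_1_def d_2_def emb_def theta1_def theta2_def cst_def
          koszul_def sfun_part_def gr_defs single_uminus algebra_simps)
    finally show "D a = vector_field (D (t_pow 1)) (D theta1) (D theta2) a" .
  qed
qed

lemma vector_field_add:
  "vector_field f f1 f2 a + vector_field g g1 g2 a = vector_field (f + g) (f1 + g1) (f2 + g2) a"
  by (simp add: vector_field_def algebra_simps)

lemma sfun_part_sum: "sfun_part 0 f + sfun_part 1 f = f"
  by (cases f) (simp add: sfun_part_def gr_defs)

lemma sfun_part_sum': "sfun_part 1 f + sfun_part 0 f = f"
  by (cases f) (simp add: sfun_part_def gr_defs)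

lemma sfun_part_idem: "sfun_part p (sfun_part p f) = sfun_part p f"
  by (cases f) (simp add: sfun_part_def)

lemma W2_carrier: "scarrier W2 = {vector_field f f1 f2 | f f1 f2. True}"
proof (intro equalityI subsetI)
  fix D assume "D \<in> scarrier W2"
  then obtain D0 D1 where *: "D = op_plus sfun_algebra D0 D1"
      "D0 \<in> superder sfun_algebra 0" "D1 \<in> superder sfun_algebra 1"
    by (auto simp: W2_def Der_def)
  have "D = (\<lambda>a. D0 a + D1 a)" using *(1) by (simp add: op_plus_def restrict_UNIV)
  then have "D = vector_field (D0 (t_pow 1) + D1 (t_pow 1)) (D0 theta1 + D1 theta1) (D0 theta2 + D1 theta2)"
    using superder_eq_vector_field(1)[OF *(2)] superder_eq_vector_field(1)[OF *(3)]
    by (intro ext) (metis vector_field_add)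
  then show "D \<in> {vector_field f f1 f2 | f f1 f2. True}" by blast
next
  fix D assume "D \<in> {vector_field f f1 f2 | f f1 f2. True}"
  then obtain f f1 f2 where D: "D = vector_field f f1 f2" by blast
  \<comment> \<open>Even and odd part of the field are found by sorting its coefficients, with
    parities reversed for \<partial>_1 and \<partial>_2.\<close>
  have "D = op_plus sfun_algebra
      (vector_field (sfun_part 0 f) (sfun_part 1 f1) (sfun_part 1 f2))
      (vector_field (sfun_part 1 f) (sfun_part 0 f1) (sfun_part 0 f2))"
    unfolding D by (auto simp: op_plus_def restrict_UNIV vector_field_add sfun_part_sum sfun_part_sum')
  moreover have "vector_field (sfun_part 0 f) (sfun_part 1 f1) (sfun_part 1 f2) \<in> superder sfun_algebra 0"
    by (rule superder_vector_field) (simp_all add: sfun_part_idem)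
  moreover have "vector_field (sfun_part 1 f) (sfun_part 0 f1) (sfun_part 0 f2) \<in> superder sfun_algebra 1"
    by (rule superder_vector_field) (simp_all add: sfun_part_idem)
  ultimately show "D \<in> scarrier W2" by (auto simp: W2_def Der_def)
qed

lemma W2_simps [simp]:
  "splus W2 = op_plus sfun_algebra" "sscale W2 = op_scale sfun_algebra"
  "sprod W2 = supercomm sfun_algebra" "spart W2 = op_part sfun_algebra"
  "szero W2 = (\<lambda>x. 0)"
  by (simp_all add: W2_def Der_def restrict_UNIV)

lemma op_part_vector_field:
  "op_part sfun_algebra p (vector_field f f1 f2) =
     vector_field (sfun_part p f) (sfun_part (p + 1) f1) (sfun_part (p + 1) f2)"
proof
  fix a
  show "op_part sfun_algebra p (vector_field f f1 f2) a =
     vector_field (sfun_part p f) (sfun_part (p + 1) f1) (sfun_part (p + 1) f2) a"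
    using bit_cases[of p]
    by (cases a; cases f; cases f1; cases f2)
      (auto simp: op_part_def vector_field_def d_t_def d_1_def d_2_def sfun_part_def gr_defs)
qed

text \<open>Second-order terms cancel, so each coefficient is V applied to that of W minus W applied
  to that of V. The sign is reversed only for the odd part of W against the odd part of V, hence the
  separate \<open>W0\<close> and \<open>W1\<close>.\<close>

lemma supercomm_vector_field:
  "supercomm sfun_algebra (vector_field f f1 f2) (vector_field g g1 g2) =
    (let V = vector_field f f1 f2;
         W = vector_field g g1 g2;
         W0 = vector_field (sfun_part 0 g) (sfun_part 1 g1) (sfun_part 1 g2);
         W1 = vector_field (sfun_part 1 g) (sfun_part 0 g1) (sfun_part 0 g2)
     in vector_field
       (V g - W (sfun_part 0 f) - W0 (sfun_part 1 f) + W1 (sfun_part 1 f))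
       (V g1 - W (sfun_part 1 f1) - W0 (sfun_part 0 f1) + W1 (sfun_part 0 f1))
       (V g2 - W (sfun_part 1 f2) - W0 (sfun_part 0 f2) + W1 (sfun_part 0 f2)))"
    (is "?L = ?R")
proof
  fix a :: sfun
  obtain a0 a1 a2 a3 where a: "a = Gr a0 a1 a2 a3" by (cases a)
  obtain f0 f1' f2' f3 where f: "f = Gr f0 f1' f2' f3" by (cases f)
  obtain g0 g1' g2' g3 where g: "g = Gr g0 g1' g2' g3" by (cases g)
  obtain h0 h1 h2 h3 where h: "f1 = Gr h0 h1 h2 h3" by (cases f1)
  obtain k0 k1 k2 k3 where k: "f2 = Gr k0 k1 k2 k3" by (cases f2)
  obtain l0 l1 l2 l3 where l: "g1 = Gr l0 l1 l2 l3" by (cases g1)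
  obtain m0 m1 m2 m3 where m: "g2 = Gr m0 m1 m2 m3" by (cases g2)
  show "?L a = ?R a"
    unfolding supercomm_def op_part_vector_field Let_def op_plus_def op_scale_def op_comp_def
      sfun_algebra_simps restrict_UNIV a f g h k l m
    by (simp add: sfun_part_def vector_field_def d_t_def d_1_def d_2_def koszul_def cst_def gr_defs
        single_uminus, simp add: algebra_simps)
qed


section \<open>Coordinates on the divergence-free fields\<close>

text \<open>One constructor for each family of basis elements; \<open>KG\<close> stands for the
  family h, as \<open>KH\<close> is taken by H.\<close>

datatype kind = KL | KE | KH | KF | KX | KP | KG | KY

type_synonym coords = "kind \<Rightarrow> laurent"

lemma coords_eqI:
  fixes u v :: coords
  assumes "u KL = v KL" "u KE = v KE" "u KH = v KH" "u KF = v KF"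
    "u KX = v KX" "u KP = v KP" "u KG = v KG" "u KY = v KY"
  shows "u = v"
proof
  fix k show "u k = v k" using assms by (cases k) simp_all
qed

text \<open>The derivative conjugated by t^\<alpha>, that is t^(-\<alpha>) \<partial>_t (t^\<alpha>
  f). In this form the twist enters the divergence without non-integral exponents.\<close>

definition tderiv :: "complex \<Rightarrow> laurent \<Rightarrow> laurent" where
  "tderiv \<alpha> f = laurent_deriv f + Poly_Mapping.single (- 1) \<alpha> * f"

text \<open>The signs are chosen such that every basis element of \<open>S'(2,\<alpha>)\<close> has a power of \<open>t\<close> as its only
  nonzero coordinate; the last argument is the coefficient of \<open>\<theta>\<^sub>1\<theta>\<^sub>2 \<partial>\<^sub>t\<close>, which vanishes on \<open>S'(2,\<alpha>)\<close>.\<close>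

definition field_of :: "complex \<Rightarrow> coords \<Rightarrow> laurent \<Rightarrow> sfun \<Rightarrow> sfun" where
  "field_of \<alpha> u z = vector_field
     (Gr (- u KL) (u KY) (u KG) z)
     (Gr (u KX) (- (half * tderiv \<alpha> (u KL)) - u KH) (u KE) (- tderiv \<alpha> (u KG)))
     (Gr (- u KP) (u KF) (- (half * tderiv \<alpha> (u KL)) + u KH) (tderiv \<alpha> (u KY)))"

text \<open>This is t^(-\<alpha>) times the Wronskian of f and t^\<alpha> g. It gives the sl(2)
  components in brackets of (x, p) fields with (h, y) fields.\<close>

definition wron :: "complex \<Rightarrow> laurent \<Rightarrow> laurent \<Rightarrow> laurent" where
  "wron \<alpha> f g = f * tderiv \<alpha> g - laurent_deriv f * g"

text \<open>The superbracket in coordinates, as \<open>field_bracket\<close> confirms.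
  \<open>KL\<close> is the vector field part, \<open>KE\<close>, \<open>KH\<close>,
  \<open>KF\<close> are sl(2) currents, and (\<open>KX\<close>, \<open>KP\<close>) and
  (\<open>KG\<close>, \<open>KY\<close>) are two odd doublets. Being stated for arbitrary Laurent
  polynomials, it replaces tables of structure constants.\<close>

fun bracket :: "complex \<Rightarrow> coords \<Rightarrow> coords \<Rightarrow> coords" where
  "bracket \<alpha> u v KL = laurent_deriv (u KL) * v KL - u KL * laurent_deriv (v KL)
     - u KX * v KY - u KY * v KX + u KP * v KG + u KG * v KP"
| "bracket \<alpha> u v KE = laurent_deriv (u KE) * v KL - u KL * laurent_deriv (v KE)
     + 2 * (u KH * v KE - u KE * v KH) - wron \<alpha> (u KX) (v KG) - wron \<alpha> (v KX) (u KG)"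
| "bracket \<alpha> u v KH = laurent_deriv (u KH) * v KL - u KL * laurent_deriv (v KH)
     + (u KE * v KF - u KF * v KE)
     + half * (wron \<alpha> (u KX) (v KY) + wron \<alpha> (v KX) (u KY)
       + wron \<alpha> (u KP) (v KG) + wron \<alpha> (v KP) (u KG))"
| "bracket \<alpha> u v KF = laurent_deriv (u KF) * v KL - u KL * laurent_deriv (v KF)
     - 2 * (u KH * v KF - u KF * v KH) + wron \<alpha> (u KP) (v KY) + wron \<alpha> (v KP) (u KY)"
| "bracket \<alpha> u v KX = laurent_deriv (u KX) * v KL - u KL * laurent_deriv (v KX)
     + half * (tderiv \<alpha> (u KL) * v KX - tderiv \<alpha> (v KL) * u KX)
     + (u KH * v KX - u KX * v KH) + (u KE * v KP - u KP * v KE)"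
| "bracket \<alpha> u v KP = laurent_deriv (u KP) * v KL - u KL * laurent_deriv (v KP)
     + half * (tderiv \<alpha> (u KL) * v KP - tderiv \<alpha> (v KL) * u KP)
     - (u KH * v KP - u KP * v KH) + (u KF * v KX - u KX * v KF)"
| "bracket \<alpha> u v KG = laurent_deriv (u KG) * v KL - u KL * laurent_deriv (v KG)
     + laurent_deriv (u KL) * v KG - u KG * laurent_deriv (v KL)
     - half * (tderiv \<alpha> (u KL) * v KG - tderiv \<alpha> (v KL) * u KG)
     + (u KH * v KG - u KG * v KH) + (u KE * v KY - u KY * v KE)"
| "bracket \<alpha> u v KY = laurent_deriv (u KY) * v KL - u KL * laurent_deriv (v KY)
     + laurent_deriv (u KL) * v KY - u KY * laurent_deriv (v KL)
     - half * (tderiv \<alpha> (u KL) * v KY - tderiv \<alpha> (v KL) * u KY)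
     - (u KH * v KY - u KY * v KH) + (u KF * v KG - u KG * v KF)"

lemma tderiv_simps [simp]:
  "tderiv \<alpha> 0 = 0" "tderiv \<alpha> (f + g) = tderiv \<alpha> f + tderiv \<alpha> g"
  "tderiv \<alpha> (f - g) = tderiv \<alpha> f - tderiv \<alpha> g" "tderiv \<alpha> (- f) = - tderiv \<alpha> f"
  by (simp_all add: tderiv_def algebra_simps)

text \<open>Rescaling by \<open>rescale\<close> turns the structure constants of \<open>bracket\<close> into integers, which lets
  the ring identities below be decided by normalisation.\<close>

definition rescale :: "coords \<Rightarrow> coords" where
  "rescale u = (\<lambda>k. (if k = KL \<or> k = KX \<or> k = KP then 2 else 1) * u k)"

fun int_bracket :: "complex \<Rightarrow> coords \<Rightarrow> coords \<Rightarrow> coords" where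
  "int_bracket \<alpha> u v KL = 2 * (laurent_deriv (u KL) * v KL - u KL * laurent_deriv (v KL))
     - u KX * v KY - u KY * v KX + u KP * v KG + u KG * v KP"
| "int_bracket \<alpha> u v KE = 2 * (laurent_deriv (u KE) * v KL - u KL * laurent_deriv (v KE)
     + (u KH * v KE - u KE * v KH) - wron \<alpha> (u KX) (v KG) - wron \<alpha> (v KX) (u KG))"
| "int_bracket \<alpha> u v KH = 2 * (laurent_deriv (u KH) * v KL - u KL * laurent_deriv (v KH))
     + (u KE * v KF - u KF * v KE) + wron \<alpha> (u KX) (v KY) + wron \<alpha> (v KX) (u KY)
     + wron \<alpha> (u KP) (v KG) + wron \<alpha> (v KP) (u KG)"
| "int_bracket \<alpha> u v KF = 2 * (laurent_deriv (u KF) * v KL - u KL * laurent_deriv (v KF)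
     - (u KH * v KF - u KF * v KH) + wron \<alpha> (u KP) (v KY) + wron \<alpha> (v KP) (u KY))"
| "int_bracket \<alpha> u v KX = 2 * (laurent_deriv (u KX) * v KL - u KL * laurent_deriv (v KX))
     + (tderiv \<alpha> (u KL) * v KX - tderiv \<alpha> (v KL) * u KX)
     + (u KH * v KX - u KX * v KH) + (u KE * v KP - u KP * v KE)"
| "int_bracket \<alpha> u v KP = 2 * (laurent_deriv (u KP) * v KL - u KL * laurent_deriv (v KP))
     + (tderiv \<alpha> (u KL) * v KP - tderiv \<alpha> (v KL) * u KP)
     - (u KH * v KP - u KP * v KH) + (u KF * v KX - u KX * v KF)"
| "int_bracket \<alpha> u v KG = 2 * (laurent_deriv (u KG) * v KL - u KL * laurent_deriv (v KG)
     + laurent_deriv (u KL) * v KG - u KG * laurent_deriv (v KL))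
     - (tderiv \<alpha> (u KL) * v KG - tderiv \<alpha> (v KL) * u KG)
     + (u KH * v KG - u KG * v KH) + (u KE * v KY - u KY * v KE)"
| "int_bracket \<alpha> u v KY = 2 * (laurent_deriv (u KY) * v KL - u KL * laurent_deriv (v KY)
     + laurent_deriv (u KL) * v KY - u KY * laurent_deriv (v KL))
     - (tderiv \<alpha> (u KL) * v KY - tderiv \<alpha> (v KL) * u KY)
     - (u KH * v KY - u KY * v KH) + (u KF * v KG - u KG * v KF)"

lemma laurent_deriv_numeral [simp]: "laurent_deriv (numeral n) = 0"
  by (simp flip: single_numeral)

lemma tderiv_double: "tderiv \<alpha> (2 * f) = 2 * tderiv \<alpha> f"
  by (simp add: tderiv_def algebra_simps)

lemma wron_double: "wron \<alpha> (2 * f) g = 2 * wron \<alpha> f g"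
  by (simp add: wron_def algebra_simps)

lemma half_distrib:
  "half * (2 * a * b - 2 * c * d) = a * b - c * d"
  "half * (2 * a + 2 * b + 2 * c + 2 * d) = a + b + c + d"
  by (simp_all add: distrib_left right_diff_distrib mult.assoc half_double)

text \<open>Normalisation leaves \<open>half\<close> in front of monomials with an even numeral
  somewhere inside; these rules cancel it in each position that occurs.\<close>

lemma half_times_even:
  "half * (a * 2) = a" "half * (4 * a) = 2 * a" "half * (a * 4) = 2 * a"
  "half * (a * (b * 2)) = a * b" "half * (a * (b * 4)) = 2 * (a * b)"
  "half * (a * (2 * b)) = a * b" "half * (a * (4 * b)) = 2 * (a * b)"
  "half * (a * (b * (c * 2))) = a * (b * c)" "half * (a * (b * (c * 4))) = 2 * (a * (b * c))"
  "half * (a * (b * (2 * c))) = a * (b * c)" "half * (a * (b * (4 * c))) = 2 * (a * (b * c))"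
proof -
  have *: "half * (f * 2) = f" "half * (f * 4) = 2 * f" for f
    using half_double(3)[of f] half_double(3)[of "2 * f"] by (simp_all add: mult.commute)
  show "half * (a * 2) = a" "half * (4 * a) = 2 * a" "half * (a * 4) = 2 * a"
    "half * (a * (b * 2)) = a * b" "half * (a * (b * 4)) = 2 * (a * b)"
    "half * (a * (2 * b)) = a * b" "half * (a * (4 * b)) = 2 * (a * b)"
    "half * (a * (b * (c * 2))) = a * (b * c)" "half * (a * (b * (c * 4))) = 2 * (a * (b * c))"
    "half * (a * (b * (2 * c))) = a * (b * c)" "half * (a * (b * (4 * c))) = 2 * (a * (b * c))"
    using *[of a] *[of "a * b"] *[of "a * (b * c)"] by (simp_all only: ac_simps)
qed

lemma bracket_rescale: "bracket \<alpha> (rescale u) (rescale v) = rescale (int_bracket \<alpha> u v)"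
  by (rule coords_eqI)
    (simp_all add: rescale_def tderiv_double wron_double half_distrib, simp_all add: algebra_simps half_times_even)

lemma rescale_surj: "\<exists>v. u = rescale v"
proof
  show "u = rescale (\<lambda>k. (if k = KL \<or> k = KX \<or> k = KP then half else 1) * u k)"
    by (auto simp: rescale_def half_double)
qed

text \<open>The adjoint action of \<open>- z \<theta>\<^sub>1\<theta>\<^sub>2 \<partial>\<^sub>t\<close>, which lies in \<open>S(2,\<alpha>)\<close> if \<open>tderiv \<alpha> z = 0\<close>.\<close>

definition zshift :: "laurent \<Rightarrow> coords \<Rightarrow> coords" where
  "zshift z u = (\<lambda>k. case k of KG \<Rightarrow> z * u KX | KY \<Rightarrow> z * u KP | _ \<Rightarrow> 0)"

text \<open>No bracket has a \<theta>_1\<theta>_2 \<partial>_t component, which is why passing to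
  the derived algebra removes it. The given components z and w act only through
  \<open>zshift\<close>.\<close>

lemma supercomm_field_of:
  assumes "tderiv \<alpha> z = 0" "tderiv \<alpha> w = 0"
  shows "supercomm sfun_algebra (field_of \<alpha> u z) (field_of \<alpha> v w) =
    field_of \<alpha> (bracket \<alpha> u v + zshift w u - zshift z v) 0"
proof -
  define k where "k = Poly_Mapping.single (- 1 :: int) \<alpha>"
  have z: "laurent_deriv z = - (k * z)" and w: "laurent_deriv w = - (k * w)"
    using assms by (simp_all add: tderiv_def k_def add_eq_0_iff2)
  have td: "tderiv \<alpha> f = laurent_deriv f + k * f" for f
    by (simp add: tderiv_def k_def)
  obtain u' v' where uv: "u = rescale u'" "v = rescale v'"
    using rescale_surj by meson
  show ?thesis
    unfolding field_of_def supercomm_vector_field Let_def uv plus_fun_apply minus_apply bracket_rescale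
    by (rule arg_cong3[where f = vector_field])
     (simp_all add: rescale_def sfun_part_def vector_field_def d_t_def d_1_def d_2_def gr_defs
       zshift_def tderiv_double half_double,
      simp_all add: td wron_def z w,
     simp_all add: algebra_simps half_times_even)
qed

section \<open>Bilinearity, grading and super Jacobi identity of the bracket\<close>

lemma int_bracket_add:
  "int_bracket \<alpha> u (v + w) = int_bracket \<alpha> u v + int_bracket \<alpha> u w"
  "int_bracket \<alpha> (v + w) u = int_bracket \<alpha> v u + int_bracket \<alpha> w u"
  by (rule coords_eqI; simp add: wron_def; simp add: algebra_simps)+

fun kind_parity :: "kind \<Rightarrow> bit" where
  "kind_parity KL = 0" | "kind_parity KE = 0" | "kind_parity KH = 0" | "kind_parity KF = 0"
| "kind_parity KX = 1" | "kind_parity KP = 1" | "kind_parity KG = 1" | "kind_parity KY = 1"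

definition cpart :: "bit \<Rightarrow> coords \<Rightarrow> coords" where
  "cpart p u = (\<lambda>k. if kind_parity k = p then u k else 0)"

definition cscale :: "complex \<Rightarrow> coords \<Rightarrow> coords" where
  "cscale c u = (\<lambda>k. const c * u k)"

text \<open>A direct verification. Fixing the parities of u and v makes half of their coordinates
  vanish and the sign explicit; w may be inhomogeneous by linearity.\<close>

lemma int_bracket_jacobi:
  assumes "cpart p u = u" "cpart q v = v"
  shows "int_bracket \<alpha> u (int_bracket \<alpha> v w) =
    int_bracket \<alpha> (int_bracket \<alpha> u v) w + cscale (koszul p q) (int_bracket \<alpha> v (int_bracket \<alpha> u w))"
proof -
  \<comment> \<open>The function \<alpha>/t is hidden behind a letter: the identity holds for any
    \<open>k\<close>, so \<open>k\<close> and its derivative are treated as atoms.\<close>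
  define k where "k = Poly_Mapping.single (- 1 :: int) \<alpha>"
  have td: "tderiv \<alpha> f = laurent_deriv f + k * f" for f
    by (simp add: tderiv_def k_def)
  have even: "x KX = 0" "x KP = 0" "x KG = 0" "x KY = 0" if "cpart 0 x = x" for x
    using that by (auto simp: cpart_def fun_eq_iff dest: spec[of _ KX] spec[of _ KP] spec[of _ KG] spec[of _ KY])
  have odd: "x KL = 0" "x KE = 0" "x KH = 0" "x KF = 0" if "cpart 1 x = x" for x
    using that by (auto simp: cpart_def fun_eq_iff dest: spec[of _ KL] spec[of _ KE] spec[of _ KH] spec[of _ KF])
  consider "p = 0" "q = 0" | "p = 0" "q = 1" | "p = 1" "q = 0" | "p = 1" "q = 1"
    using bit_cases by blast
  then show ?thesis
  proof cases
    case 1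
    note [simp] = even[OF assms(1)[unfolded 1]] even[OF assms(2)[unfolded 1]]
    show ?thesis
     by (rule coords_eqI; simp add: wron_def td 1 koszul_def cscale_def; simp add: algebra_simps)
  next
    case 2
    note [simp] = even[OF assms(1)[unfolded 2]] odd[OF assms(2)[unfolded 2]]
    show ?thesis
     by (rule coords_eqI; simp add: wron_def td 2 koszul_def cscale_def; simp add: algebra_simps)
  next
    case 3
    note [simp] = odd[OF assms(1)[unfolded 3]] even[OF assms(2)[unfolded 3]]
    show ?thesis
     by (rule coords_eqI; simp add: wron_def td 3 koszul_def cscale_def; simp add: algebra_simps)
  next
    case 4
    note [simp] = odd[OF assms(1)[unfolded 4]] odd[OF assms(2)[unfolded 4]]
    show ?thesis
     by (rule coords_eqI; simp add: wron_def td 4 koszul_def cscale_def single_uminus; simp add: algebra_simps)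
  qed
qed

lemma rescale_inject: "rescale u = rescale v \<longleftrightarrow> u = v"
proof
  assume *: "rescale u = rescale v"
  show "u = v"
  proof
    fix k
    have "rescale u k = rescale v k" using * by simp
    then show "u k = v k"
      by (auto simp: rescale_def dest: laurent_double_cancel split: if_splits)
  qed
qed simp

lemma rescale_cpart: "cpart p (rescale u) = rescale (cpart p u)"
  by (auto simp: cpart_def rescale_def)

lemma rescale_cscale: "cscale c (rescale u) = rescale (cscale c u)"
  by (auto simp: cscale_def rescale_def algebra_simps)

lemma rescale_add: "rescale (u + v) = rescale u + rescale v"
  by (auto simp: rescale_def algebra_simps)

lemma bracket_jacobi:
  assumes "cpart p u = u" "cpart q v = v"
  shows "bracket \<alpha> u (bracket \<alpha> v w) =
    bracket \<alpha> (bracket \<alpha> u v) w + cscale (koszul p q) (bracket \<alpha> v (bracket \<alpha> u w))"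
proof -
  obtain u' v' w' where *: "u = rescale u'" "v = rescale v'" "w = rescale w'"
    using rescale_surj by metis
  have "cpart p u' = u'" "cpart q v' = v'"
    using assms by (simp_all add: * rescale_cpart rescale_inject)
  from int_bracket_jacobi[OF this] show ?thesis
    by (simp only: * bracket_rescale rescale_cscale flip: rescale_add)
qed

lemma bracket_add:
  "bracket \<alpha> u (v + w) = bracket \<alpha> u v + bracket \<alpha> u w"
  "bracket \<alpha> (v + w) u = bracket \<alpha> v u + bracket \<alpha> w u"
proof -
  obtain u' v' w' where *: "u = rescale u'" "v = rescale v'" "w = rescale w'"
    using rescale_surj by metis
  show "bracket \<alpha> u (v + w) = bracket \<alpha> u v + bracket \<alpha> u w"
    "bracket \<alpha> (v + w) u = bracket \<alpha> v u + bracket \<alpha> w u"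
    unfolding * by (simp_all only: bracket_rescale int_bracket_add flip: rescale_add)
qed

lemma bracket_scale:
  "bracket \<alpha> u (cscale c v) = cscale c (bracket \<alpha> u v)"
  "bracket \<alpha> (cscale c u) v = cscale c (bracket \<alpha> u v)"
  by (rule coords_eqI; simp add: cscale_def wron_def tderiv_def; simp add: algebra_simps)+

lemma cpart_simps [simp]:
  "cpart p (cpart p u) = cpart p u" "cpart p (u + v) = cpart p u + cpart p v"
  "cpart 0 u + cpart 1 u = u" "cpart 1 u + cpart 0 u = u" "cpart p (cscale c u) = cscale c (cpart p u)"
  "cpart p 0 = 0"
  by (auto simp: cpart_def cscale_def fun_eq_iff)

lemma cpart_bracket:
  assumes "cpart p u = u" "cpart q v = v"
  shows "cpart (p + q) (bracket \<alpha> u v) = bracket \<alpha> u v"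
proof -
  have comp: "x k = 0" if "cpart r x = x" "kind_parity k \<noteq> r" for r x k
    using that by (metis cpart_def)
  show ?thesis
    using bit_cases[of p] bit_cases[of q] comp[OF assms(1)] comp[OF assms(2)]
    by (intro coords_eqI) (auto simp: cpart_def wron_def)
qed

text \<open>\<open>tw \<alpha>\<close> is \<open>t\<close> to the power \<open>\<alpha>\<close>. With the value \<open>0\<close> for non-integral \<open>\<alpha>\<close>, the rules for its derivative
  hold without a case distinction.\<close>

definition tw :: "complex \<Rightarrow> laurent" where
  "tw \<alpha> = (if \<alpha> \<in> \<int> then Poly_Mapping.single \<lfloor>Re \<alpha>\<rfloor> 1 else 0)"

definition tw_inv :: "complex \<Rightarrow> laurent" where
  "tw_inv \<alpha> = (if \<alpha> \<in> \<int> then Poly_Mapping.single (- \<lfloor>Re \<alpha>\<rfloor>) 1 else 0)"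

lemma tw_deriv:
  "laurent_deriv (tw \<alpha>) = Poly_Mapping.single (- 1) \<alpha> * tw \<alpha>"
  "laurent_deriv (tw_inv \<alpha>) = - (Poly_Mapping.single (- 1) \<alpha> * tw_inv \<alpha>)"
  "tw \<alpha> * tw_inv \<alpha> = (if \<alpha> \<in> \<int> then 1 else 0)"
proof -
  have *: "- 1 - n = - n - 1" for n :: int by simp
  show "laurent_deriv (tw_inv \<alpha>) = - (Poly_Mapping.single (- 1) \<alpha> * tw_inv \<alpha>)"
    by (auto simp: tw_inv_def mult_single single_uminus[symmetric] elim!: Ints_cases) (simp only: *)
qed (auto simp: tw_def tw_inv_def mult_single elim!: Ints_cases)

section \<open>Outer derivations from matrices mixing the two odd doublets\<close>

definition outer :: "complex \<Rightarrow> complex^2^2 \<Rightarrow> coords \<Rightarrow> coords" where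
  "outer \<alpha> m u = (\<lambda>k. case k of
       KX \<Rightarrow> const (m $ 1 $ 1) * u KX + const (m $ 1 $ 2) * tw \<alpha> * u KG
     | KP \<Rightarrow> const (m $ 1 $ 1) * u KP + const (m $ 1 $ 2) * tw \<alpha> * u KY
     | KG \<Rightarrow> const (m $ 2 $ 1) * tw_inv \<alpha> * u KX + const (m $ 2 $ 2) * u KG
     | KY \<Rightarrow> const (m $ 2 $ 1) * tw_inv \<alpha> * u KP + const (m $ 2 $ 2) * u KY
     | _ \<Rightarrow> 0)"

lemma trace_2: "trace (m :: complex^2^2) = m $ 1 $ 1 + m $ 2 $ 2"
  by (simp add: trace_def sum_2)

text \<open>Multiplication by t^\<alpha> carries the action of the even part on (h, y) to that on
  (x, p), so mixing the doublets commutes with it. The even components of a bracket of odd fields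
  pair the two doublets, and trace zero makes this pairing invariant. The entry (2, 1) alone yields
  \<open>zshift\<close> by a multiple of t^(-\<alpha>), a trace of the larger algebra
  S(2,\<alpha>).\<close>

lemma outer_bracket:
  assumes "trace m = 0"
  shows "outer \<alpha> m (bracket \<alpha> u v) = bracket \<alpha> (outer \<alpha> m u) v + bracket \<alpha> u (outer \<alpha> m v)"
proof -
  obtain u' v' where uv: "u = rescale u'" "v = rescale v'"
    using rescale_surj by meson
  define k where "k = Poly_Mapping.single (- 1 :: int) \<alpha>"
  have td: "tderiv \<alpha> f = laurent_deriv f + k * f" for f
    by (simp add: tderiv_def k_def)
  have m22: "m $ 2 $ 2 = - m $ 1 $ 1"
    using assms by (simp add: trace_2 eq_neg_iff_add_eq_0 add.commute)
  \<comment> \<open>\<open>rescale\<close> doubles \<open>KX\<close> and \<open>KP\<close> but not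
    \<open>KG\<close> and \<open>KY\<close>. The factor 1/2 put into \<open>b\<close> compensates
    for this, so that \<open>out\<close> has integral coefficients.\<close>
  define a b c where "a = const (m $ 1 $ 1)" and "b = half * const (m $ 1 $ 2)" and "c = const (m $ 2 $ 1)"
  have b2: "const (m $ 1 $ 2) = 2 * b"
    by (simp add: b_def half_double)
  have d: "laurent_deriv a = 0" "laurent_deriv b = 0" "laurent_deriv c = 0"
    by (simp_all add: a_def b_def c_def)
  note tw = tw_deriv(1,2)[of \<alpha>, folded k_def]
  define out where "out u = (\<lambda>k. case k of
       KX \<Rightarrow> a * u KX + b * tw \<alpha> * u KG | KP \<Rightarrow> a * u KP + b * tw \<alpha> * u KY
     | KG \<Rightarrow> 2 * c * tw_inv \<alpha> * u KX - a * u KG | KY \<Rightarrow> 2 * c * tw_inv \<alpha> * u KP - a * u KY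
     | _ \<Rightarrow> 0)" for u
  have *: "outer \<alpha> m (rescale u) = rescale (out u)" for u
    by (rule coords_eqI;
      simp add: outer_def out_def rescale_def m22 single_uminus b2 flip: a_def c_def;
      simp add: algebra_simps)
  have "out (int_bracket \<alpha> u v) = int_bracket \<alpha> (out u) v + int_bracket \<alpha> u (out v)" for u v
    by (rule coords_eqI; simp add: out_def wron_def td d tw; simp add: algebra_simps)
  then show ?thesis
    by (simp only: uv bracket_rescale * flip: rescale_add)
qed

lemma outer_linear [simp]:
  "outer \<alpha> m (u + v) = outer \<alpha> m u + outer \<alpha> m v" "outer \<alpha> m (cscale c u) = cscale c (outer \<alpha> m u)"
  "outer \<alpha> (m + n) u = outer \<alpha> m u + outer \<alpha> n u"
  "outer \<alpha> (\<chi> i j. c * m $ i $ j) u = cscale c (outer \<alpha> m u)"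
  by (rule coords_eqI; simp add: outer_def cscale_def single_add flip: mult_single[where k = 0 and l = 0, simplified]; simp add: algebra_simps)+

lemma outer_cpart: "outer \<alpha> m (cpart p u) = cpart p (outer \<alpha> m u)"
  using bit_cases[of p] by (intro coords_eqI) (auto simp: outer_def cpart_def)

text \<open>For integral \<alpha> the factors \<open>tw \<alpha>\<close> and
  \<open>tw_inv \<alpha>\<close> are inverse to each other, so \<open>outer\<close> respects matrix
  products. Otherwise both are 0 and products of off-diagonal entries would be lost; there the
  matrices are taken diagonal.\<close>

lemma outer_commutator:
  assumes "\<alpha> \<in> \<int> \<or> m $ 1 $ 2 = 0 \<and> m $ 2 $ 1 = 0"
    and "\<alpha> \<in> \<int> \<or> n $ 1 $ 2 = 0 \<and> n $ 2 $ 1 = 0"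
  shows "outer \<alpha> m (outer \<alpha> n u) - outer \<alpha> n (outer \<alpha> m u) = outer \<alpha> (m ** n - n ** m) u"
proof -
  have cm: "const (c * d) = const c * const d" for c d by (simp add: mult_single)
  have tw: "tw \<alpha> * (tw_inv \<alpha> * f) = (if \<alpha> \<in> \<int> then f else 0)"
     "tw_inv \<alpha> * (tw \<alpha> * f) = (if \<alpha> \<in> \<int> then f else 0)"for f
    using tw_deriv(3)[of \<alpha>]
    by (cases "\<alpha> \<in> \<int>"; simp add: tw_def tw_inv_def mult_single flip: mult.assoc)+
  show ?thesis
    by (rule coords_eqI; simp add: outer_def matrix_matrix_mult_def sum_2 single_add single_diff cm;
      use assms in \<open>auto simp add: algebra_simps tw\<close>)
qed

section \<open>The carriers of S(2,\<alpha>) and S'(2,\<alpha>) in coordinates\<close>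

lemma vector_field_coeffs:
  "vector_field f f1 f2 (t_pow 1) = f" "vector_field f f1 f2 theta1 = f1"
  "vector_field f f1 f2 theta2 = f2"
proof -
  have "d_t (t_pow 1) = 1" "d_1 (t_pow 1) = 0" "d_2 (t_pow 1) = 0"
    "d_t theta1 = 0" "d_1 theta1 = 1" "d_2 theta1 = 0"
    "d_t theta2 = 0" "d_1 theta2 = 0" "d_2 theta2 = 1"
    by (simp_all add: d_t_def d_1_def d_2_def t_pow_def theta1_def theta2_def gr_defs)
  then show "vector_field f f1 f2 (t_pow 1) = f" "vector_field f f1 f2 theta1 = f1"
    "vector_field f f1 f2 theta2 = f2"
    by (simp_all add: vector_field_def)
qed

lemma vector_field_inject:
  "vector_field f f1 f2 = vector_field g g1 g2 \<longleftrightarrow> f = g \<and> f1 = g1 \<and> f2 = g2"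
  by (metis vector_field_coeffs)

lemma twisted_div_vector_field:
  "twisted_div \<alpha> (vector_field (Gr a0 a1 a2 a3) (Gr b0 b1 b2 b3) (Gr c0 c1 c2 c3)) =
    Gr (tderiv \<alpha> a0 - b1 - c2) (tderiv \<alpha> a1 - c3) (tderiv \<alpha> a2 + b3) (tderiv \<alpha> a3)"
  unfolding twisted_div_def Div_def vector_field_coeffs
  by (simp add: parity_sign_def sfun_part_def cst_def
      t_pow_def d_t_def d_1_def d_2_def tderiv_def gr_defs mult_single)

lemma half_tderiv_add: "half * tderiv \<alpha> f + half * tderiv \<alpha> f = tderiv \<alpha> f"
  using half_double(2)[of "tderiv \<alpha> f"] unfolding mult_2 .

text \<open>The divergence condition has four Grassmann components. One fixes the sum of the two
  diagonal coefficients, so that half their difference is the free coordinate \<open>KH\<close>; two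
  determine the \<theta>_1\<theta>_2 coefficients of \<partial>_1 and \<partial>_2; the last
  constrains z.\<close>

lemma S2_carrier: "scarrier (S2 \<alpha>) = {field_of \<alpha> u z | u z. tderiv \<alpha> z = 0}"
proof (intro equalityI subsetI)
  fix D assume "D \<in> scarrier (S2 \<alpha>)"
  then obtain f f1 f2 where D: "D = vector_field f f1 f2" "twisted_div \<alpha> D = 0"
    by (auto simp: S2_def W2_carrier)
  obtain a0 a1 a2 a3 where f: "f = Gr a0 a1 a2 a3" by (cases f)
  obtain b0 b1 b2 b3 where f1: "f1 = Gr b0 b1 b2 b3" by (cases f1)
  obtain c0 c1 c2 c3 where f2: "f2 = Gr c0 c1 c2 c3" by (cases f2)
  have eq: "tderiv \<alpha> a0 = b1 + c2" "c3 = tderiv \<alpha> a1" "b3 = - tderiv \<alpha> a2" "tderiv \<alpha> a3 = 0"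
    using D(2) by (auto simp: D(1) f f1 f2 twisted_div_vector_field gr_defs algebra_simps add_eq_0_iff2)
  define u where "u = (\<lambda>k. case k of KL \<Rightarrow> - a0 | KE \<Rightarrow> b2 | KH \<Rightarrow> half * (c2 - b1) | KF \<Rightarrow> c1
    | KX \<Rightarrow> b0 | KP \<Rightarrow> - c0 | KG \<Rightarrow> a2 | KY \<Rightarrow> a1)"
  have "half * b1 + half * b1 = b1" "half * c2 + half * c2 = c2"
    using half_double(2)[of b1] half_double(2)[of c2] unfolding mult_2 by auto
  then have "- (half * (- b1 - c2)) - half * (c2 - b1) = b1"
    "half * (c2 - b1) - half * (- b1 - c2) = c2"
    by (simp_all add: algebra_simps)
  then have "D = field_of \<alpha> u a3"
    by (simp add: D(1) f f1 f2 field_of_def u_def eq)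
  with eq(4) show "D \<in> {field_of \<alpha> u z | u z. tderiv \<alpha> z = 0}" by blast
next
  fix D assume "D \<in> {field_of \<alpha> u z | u z. tderiv \<alpha> z = 0}"
  then obtain u z where D: "D = field_of \<alpha> u z" "tderiv \<alpha> z = 0" by blast
  have "D \<in> scarrier W2" by (auto simp: D(1) field_of_def W2_carrier)
  moreover have "twisted_div \<alpha> D = 0"
    using D(2) half_tderiv_add[of \<alpha> "u KL"]
    by (simp add: D(1) field_of_def twisted_div_vector_field gr_defs algebra_simps)
  ultimately show "D \<in> scarrier (S2 \<alpha>)" by (simp add: S2_def)
qed

abbreviation field :: "complex \<Rightarrow> coords \<Rightarrow> sfun \<Rightarrow> sfun" where
  "field \<alpha> u \<equiv> field_of \<alpha> u 0"

lemma field_of_add: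
  "op_plus sfun_algebra (field_of \<alpha> u z) (field_of \<alpha> v w) = field_of \<alpha> (u + v) (z + w)"
proof -
  have "op_plus sfun_algebra D D' = (\<lambda>a. D a + D' a)" for D D'
    by (simp add: op_plus_def restrict_UNIV)
  then show ?thesis
    by (simp add: field_of_def vector_field_add)
      (simp add: gr_defs vector_field_inject algebra_simps)
qed

lemma field_scale:
  "op_scale sfun_algebra c (field_of \<alpha> u z) = field_of \<alpha> (cscale c u) (const c * z)"
proof -
  have "op_scale sfun_algebra c (vector_field f f1 f2) =
      vector_field (cst c * f) (cst c * f1) (cst c * f2)" for f f1 f2
    by (simp add: op_scale_def restrict_UNIV vector_field_def algebra_simps fun_eq_iff)
  moreover have "tderiv \<alpha> (const c * f) = const c * tderiv \<alpha> f" for f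
    by (simp add: tderiv_def algebra_simps)
  ultimately show ?thesis
    by (simp add: field_of_def cst_def gr_defs vector_field_inject cscale_def algebra_simps)
qed

lemma field_part: "op_part sfun_algebra p (field \<alpha> u) = field \<alpha> (cpart p u)"
  using bit_cases[of p]
  by (auto simp: field_of_def op_part_vector_field vector_field_inject sfun_part_def cpart_def gr_defs)

lemma field_bracket: "supercomm sfun_algebra (field \<alpha> u) (field \<alpha> v) = field \<alpha> (bracket \<alpha> u v)"
proof -
  have "zshift 0 u = 0" for u
    by (rule ext) (simp add: zshift_def split: kind.split)
  then show ?thesis by (simp add: supercomm_field_of)
qed

lemma field_inject: "field \<alpha> u = field \<alpha> v \<longleftrightarrow> u = v"
proof
  assume "field \<alpha> u = field \<alpha> v"
  then show "u = v"
    by (auto simp: field_of_def vector_field_inject intro!: coords_eqI)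
qed simp

lemma field_0: "field \<alpha> 0 = (\<lambda>x. 0)"
  by (auto simp: field_of_def vector_field_def gr_defs fun_eq_iff)

lemma S2_simps [simp]:
  "splus (S2 \<alpha>) = op_plus sfun_algebra" "sscale (S2 \<alpha>) = op_scale sfun_algebra"
  "sprod (S2 \<alpha>) = supercomm sfun_algebra" "spart (S2 \<alpha>) = op_part sfun_algebra"
  "szero (S2 \<alpha>) = (\<lambda>x. 0)"
  by (simp_all add: S2_def)

lemma S2'_simps [simp]:
  "splus (S2' \<alpha>) = op_plus sfun_algebra" "sscale (S2' \<alpha>) = op_scale sfun_algebra"
  "sprod (S2' \<alpha>) = supercomm sfun_algebra" "spart (S2' \<alpha>) = op_part sfun_algebra"
  "szero (S2' \<alpha>) = field \<alpha> 0"
  by (simp_all add: S2'_def derived_def field_0)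

definition single_coord :: "kind \<Rightarrow> laurent \<Rightarrow> coords" where
  "single_coord k f = (\<lambda>j. if j = k then f else 0)"

lemma coords_decompose:
  "u = single_coord KL (u KL) + single_coord KE (u KE) + single_coord KH (u KH) + single_coord KF (u KF)
     + single_coord KX (u KX) + single_coord KP (u KP) + single_coord KG (u KG) + single_coord KY (u KY)"
  by (rule coords_eqI) (simp_all add: single_coord_def)

text \<open>Brackets lie in the range of \<open>field\<close> by \<open>supercomm_field_of\<close>.
  Conversely, every field with a single nonzero coordinate is reached by brackets and sums.\<close>

lemma S2'_carrier: "scarrier (S2' \<alpha>) = range (field \<alpha>)"
proof
  let ?B = "{sprod (S2 \<alpha>) x y | x y. x \<in> scarrier (S2 \<alpha>) \<and> y \<in> scarrier (S2 \<alpha>)}"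
  have carrier: "scarrier (S2' \<alpha>) = sspan (S2 \<alpha>) ?B"
    by (simp add: S2'_def derived_def)
  have field: "field \<alpha> u \<in> scarrier (S2 \<alpha>)" for u
    unfolding S2_carrier using tderiv_simps(1) by blast
  have "ssubspace (S2 \<alpha>) (range (field \<alpha>))"
    using field by (auto simp: ssubspace_def field_of_add field_scale field_0[of \<alpha>, symmetric])
  moreover have "?B \<subseteq> range (field \<alpha>)"
    by (auto simp: S2_carrier supercomm_field_of)
  ultimately show "scarrier (S2' \<alpha>) \<subseteq> range (field \<alpha>)"
    unfolding carrier sspan_def by blast
  show "range (field \<alpha>) \<subseteq> scarrier (S2' \<alpha>)"
    unfolding carrier sspan_def
  proof (intro subsetI InterI, clarify)
    fix u V assume V: "ssubspace (S2 \<alpha>) V" "?B \<subseteq> V"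
    have add: "field \<alpha> (u + v) \<in> V" if "field \<alpha> u \<in> V" "field \<alpha> v \<in> V" for u v
      using V(1) that by (auto simp: ssubspace_def field_of_add[of \<alpha> _ 0 _ 0, simplified, symmetric])
    have br: "field \<alpha> (bracket \<alpha> u v) \<in> V" for u v
    proof -
      have "sprod (S2 \<alpha>) (field \<alpha> u) (field \<alpha> v) \<in> ?B" using field by blast
      then show ?thesis using V(2) by (auto simp: field_bracket)
    qed
    let ?s = single_coord
    \<comment> \<open>E_0 and F_0 exchange the members of each odd doublet, and sl(2) is perfect, so
      seven of the families consist of brackets.\<close>
    have "?s KX f = bracket \<alpha> (?s KE 1) (?s KP f)" "?s KP f = bracket \<alpha> (?s KF 1) (?s KX f)"
      "?s KG f = bracket \<alpha> (?s KE 1) (?s KY f)" "?s KY f = bracket \<alpha> (?s KF 1) (?s KG f)"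
      "?s KE f = bracket \<alpha> (?s KH 1) (?s KE (half * f))"
      "?s KF f = bracket \<alpha> (?s KH (- 1)) (?s KF (half * f))"
      "?s KH f = bracket \<alpha> (?s KE 1) (?s KF f)" for f
      by (rule coords_eqI; simp add: single_coord_def wron_def half_double)+
    then have 1: "field \<alpha> (?s k f) \<in> V" if "k \<noteq> KL" for k f
      using br that by (cases k) metis+
    \<comment> \<open>The bracket of \<partial>_1 with a field of type y has the desired L part and
      an H part, which is already available for correction.\<close>
    have "?s KL f = bracket \<alpha> (?s KX 1) (?s KY (- f)) + ?s KH (half * tderiv \<alpha> f)" for f
      by (rule coords_eqI; simp add: single_coord_def wron_def)
    then have "field \<alpha> (?s KL f) \<in> V" for f
      using add br 1[of KH] by (metis kind.distinct)
    with 1 have "field \<alpha> (?s k f) \<in> V" for k f by (cases "k = KL") auto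
    then show "field \<alpha> u \<in> V"
      by (subst coords_decompose) (intro add)
  qed
qed

abbreviation unit :: "kind \<Rightarrow> int \<Rightarrow> coords" where
  "unit k n \<equiv> single_coord k (Poly_Mapping.single n 1)"

lemma bas_coords:
  "bas_L \<alpha> n = field \<alpha> (unit KL (n + 1))" "bas_E n = field \<alpha> (unit KE n)"
  "bas_H n = field \<alpha> (unit KH n)" "bas_F n = field \<alpha> (unit KF n)"
  "bas_x n = field \<alpha> (unit KX (n + 1))" "bas_p n = field \<alpha> (unit KP (n + 1))"
  "bas_h \<alpha> n = field \<alpha> (unit KG n)" "bas_y \<alpha> n = field \<alpha> (unit KY n)"
  by (simp_all add: bas_L_def bas_E_def bas_H_def bas_F_def bas_x_def bas_p_def bas_h_def bas_y_def
      field_of_def vector_field_inject t_pow_def theta1_def theta2_def cst_def single_coord_def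
      tderiv_def half_def gr_defs mult_single single_uminus[symmetric] single_add[symmetric] add_divide_distrib algebra_simps)

section \<open>Superderivations in coordinates and the weights of a torus element\<close>

lemma bracket_skew:
  assumes "cpart 0 u = u"
  shows "bracket \<alpha> v u = - bracket \<alpha> u v"
proof -
  have "u k = 0" if "kind_parity k = 1" for k
    using assms that by (metis cpart_def zero_neq_one)
  then have [simp]: "u KX = 0" "u KP = 0" "u KG = 0" "u KY = 0" by simp_all
  show ?thesis
    by (rule coords_eqI; simp add: wron_def; simp add: algebra_simps)
qed

lemma bracket_0 [simp]: "bracket \<alpha> 0 u = 0" "bracket \<alpha> u 0 = 0"
  by (rule coords_eqI; simp add: wron_def)+

lemma bracket_uminus: "bracket \<alpha> (- u) v = - bracket \<alpha> u v" "bracket \<alpha> v (- u) = - bracket \<alpha> v u"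
  using bracket_add(2)[of \<alpha> u "- u" v] bracket_add(1)[of \<alpha> v u "- u"]
  by (simp_all add: eq_neg_iff_add_eq_0 add.commute)

lemma bracket_diff:
  "bracket \<alpha> (u - w) v = bracket \<alpha> u v - bracket \<alpha> w v"
  "bracket \<alpha> v (u - w) = bracket \<alpha> v u - bracket \<alpha> v w"
  using bracket_add(2)[of \<alpha> u "- w" v] bracket_add(1)[of \<alpha> v u "- w"]
  by (simp_all add: bracket_uminus)

lemma cscale_simps [simp]: "cscale c 0 = 0" "cscale 1 u = u" "cscale 0 u = 0"
  "cscale c (u + v) = cscale c u + cscale c v" "cscale c (cscale d u) = cscale (c * d) u"
  "cscale c (u - v) = cscale c u - cscale c v" "cscale c (- u) = - cscale c u"
  "cscale (- c) u = - cscale c u"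
  by (auto simp: cscale_def fun_eq_iff algebra_simps single_uminus mult_single simp flip: mult.assoc)

text \<open>Superderivations of parity p read in coordinates; \<open>superder_S2'\<close> gives the
  correspondence with those of S'(2,\<alpha>).\<close>

definition coder :: "complex \<Rightarrow> bit \<Rightarrow> (coords \<Rightarrow> coords) \<Rightarrow> bool" where
  "coder \<alpha> p d \<longleftrightarrow>
     (\<forall>u v. d (u + v) = d u + d v) \<and> (\<forall>c u. d (cscale c u) = cscale c (d u)) \<and>
     (\<forall>q u. cpart q u = u \<longrightarrow> cpart (p + q) (d u) = d u) \<and>
     (\<forall>q u v. cpart q u = u \<longrightarrow>
        d (bracket \<alpha> u v) = bracket \<alpha> (d u) v + cscale (koszul p q) (bracket \<alpha> u (d v)))"

lemma coder_bracket: "cpart p u = u \<Longrightarrow> coder \<alpha> p (bracket \<alpha> u)"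
  unfolding coder_def
  by (intro conjI allI impI bracket_add bracket_scale bracket_jacobi cpart_bracket)

lemma coder_outer: "trace m = 0 \<Longrightarrow> coder \<alpha> 0 (outer \<alpha> m)"
  by (auto simp: coder_def outer_bracket koszul_def simp flip: outer_cpart)

lemma coder_diff:
  assumes "coder \<alpha> p d" "coder \<alpha> p e"
  shows "coder \<alpha> p (\<lambda>u. d u - e u)"
proof -
  have "cpart r (x - y) = cpart r x - cpart r y" for r x y
    by (auto simp: cpart_def)
  with assms show ?thesis
    by (simp add: coder_def bracket_diff)
qed

text \<open>The imaginary part of the coefficient of \<open>H\<^sub>0\<close> is so large that the eigenvalues of \<open>torus \<alpha>\<close> on
  the coordinates of different kinds are separated as far as possible.\<close>

definition big :: "complex \<Rightarrow> complex" where
  "big \<alpha> = Complex 0 (1 + \<bar>Im \<alpha>\<bar>)"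

definition torus :: "complex \<Rightarrow> coords" where
  "torus \<alpha> = unit KL 1 + single_coord KH (const (big \<alpha>))"

text \<open>Eigenvalues of the adjoint action of \<open>torus \<alpha>\<close> on the monomials t^n
  of each family.\<close>

fun wt :: "complex \<Rightarrow> kind \<Rightarrow> int \<Rightarrow> complex" where
  "wt \<alpha> KL n = 1 - of_int n" | "wt \<alpha> KH n = - of_int n"
| "wt \<alpha> KE n = - of_int n + 2 * big \<alpha>" | "wt \<alpha> KF n = - of_int n - 2 * big \<alpha>"
| "wt \<alpha> KX n = - of_int n + (1 + \<alpha>) / 2 + big \<alpha>" | "wt \<alpha> KP n = - of_int n + (1 + \<alpha>) / 2 - big \<alpha>"
| "wt \<alpha> KG n = - of_int n + (1 - \<alpha>) / 2 + big \<alpha>" | "wt \<alpha> KY n = - of_int n + (1 - \<alpha>) / 2 - big \<alpha>"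

lemma cpart_torus: "cpart 0 (torus \<alpha>) = torus \<alpha>"
  by (rule coords_eqI) (simp_all add: cpart_def torus_def single_coord_def)

lemma lookup_double: "Poly_Mapping.lookup (2 * f) n = 2 * Poly_Mapping.lookup (f :: laurent) n"
  by (simp only: mult_2 lookup_add)

lemma lookup_torus:
  "Poly_Mapping.lookup (bracket \<alpha> (torus \<alpha>) v k) n = wt \<alpha> k n * Poly_Mapping.lookup (v k) n"
  by (cases k; simp add: torus_def single_coord_def wron_def tderiv_def half_def lookup_add lookup_minus
     lookup_double lookup_single_mult lookup_laurent_deriv mult_single distrib_right;
     simp add: field_simps)

text \<open>Compare imaginary parts. With b = 1 + |Im \<alpha>|, they are 0 or \<plusminus>2b on
  even families and within |Im \<alpha>|/2 of \<plusminus>b on odd ones, so they never meet.\<close>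

lemma wt_parity: "wt \<alpha> j m = wt \<alpha> k n \<Longrightarrow> kind_parity j = kind_parity k"
  by (cases j; cases k; simp add: complex_eq_iff big_def; linarith)

text \<open>Only L_0 and H_0 have weight 0; they span the centralizer of
  \<open>torus \<alpha>\<close>.\<close>

lemma wt_0: "wt \<alpha> k n = 0 \<Longrightarrow> k = KL \<and> n = 1 \<or> k = KH \<and> n = 0"
  by (cases k) (auto simp add: complex_eq_iff big_def)

lemma cpart_eq_iff: "cpart p u = u \<longleftrightarrow> (\<forall>k. kind_parity k \<noteq> p \<longrightarrow> u k = 0)"
  by (auto simp: cpart_def fun_eq_iff)

text \<open>Every derivation kills \<open>torus \<alpha>\<close> up to an inner derivation, since \<open>torus \<alpha>\<close> acts semisimply and
  its centralizer acts faithfully.\<close>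

lemma coder_reduce:
  assumes d: "coder \<alpha> p d"
  shows "\<exists>u. cpart p u = u \<and> d (torus \<alpha>) = bracket \<alpha> u (torus \<alpha>)"
proof -
  let ?l = Poly_Mapping.lookup
  define w where "w = d (torus \<alpha>)"
  have w: "cpart p w = w"
    using d cpart_torus[of \<alpha>] unfolding coder_def w_def by (metis add.right_neutral)
  \<comment> \<open>Each weight component of \<open>w\<close> is divided by its weight, with a minus
    sign because the torus stands on the right of the bracket to be solved. At weight 0 division
    gives 0, so that component stays.\<close>
  define u where "u k = Poly_Mapping.mapp (\<lambda>n x. - x / wt \<alpha> k n) (w k)" for k
  have lu: "?l (u k) n = - ?l (w k) n / wt \<alpha> k n" for k n
    by (simp add: u_def lookup_mapp when_def in_keys_iff)
  have u: "cpart p u = u"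
    using w unfolding cpart_eq_iff by (simp add: poly_mapping_eqI lu)
  define e where "e v = d v - bracket \<alpha> u v" for v
  have e: "coder \<alpha> p e"
    unfolding e_def using coder_diff[OF d coder_bracket[OF u]] .
  have koszul: "koszul p 0 = 1" by (simp add: koszul_def)
  define w0 where "w0 = e (torus \<alpha>)"
  have lw0: "?l (w0 k) n = 0" if "wt \<alpha> k n \<noteq> 0" for k n
    using that by (simp add: w0_def e_def bracket_skew[OF cpart_torus] lookup_add lookup_torus lu
        flip: w_def)
  \<comment> \<open>Apply \<open>e\<close> to [T, v] = c v for a basis element v and compare
    coefficients at v itself: both terms containing e(v) contribute c times the same number and
    cancel.\<close>
  have zero: "?l (bracket \<alpha> w0 (unit k m) k) m = 0" for k m
  proof -
    have "bracket \<alpha> (torus \<alpha>) (unit k m) = cscale (wt \<alpha> k m) (unit k m)"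
      by (rule ext, rule poly_mapping_eqI)
        (auto simp: lookup_torus cscale_def lookup_single_mult single_coord_def lookup_single when_def)
    then have "cscale (wt \<alpha> k m) (e (unit k m)) =
        bracket \<alpha> w0 (unit k m) + bracket \<alpha> (torus \<alpha>) (e (unit k m))"
      using e cpart_torus[of \<alpha>] unfolding coder_def w0_def by (metis koszul cscale_simps(2))
    from arg_cong[OF this, of "\<lambda>x. ?l (x k) m"] show ?thesis
      by (simp add: lookup_add lookup_torus cscale_def lookup_single_mult)
  qed
  have "w0 k = 0" if "k \<noteq> KL" "k \<noteq> KH" for k
    using wt_0[of \<alpha> k] lw0 that by (metis poly_mapping_eqI lookup_zero)
  moreover obtain a where a: "w0 KL = Poly_Mapping.single 1 a"
  proof
    show "w0 KL = Poly_Mapping.single 1 (?l (w0 KL) 1)"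
      using lw0[of KL] by (intro poly_mapping_eqI) (auto simp: lookup_single when_def)
  qed
  moreover obtain b where b: "w0 KH = const b"
  proof
    show "w0 KH = const (?l (w0 KH) 0)"
      using lw0[of KH] by (intro poly_mapping_eqI) (auto simp: lookup_single when_def)
  qed
  ultimately have w0: "w0 = single_coord KL (Poly_Mapping.single 1 a) + single_coord KH (const b)"
    by (intro coords_eqI) (simp_all add: single_coord_def)
  \<comment> \<open>L_1 detects the coefficient of L_0, and then E_0 that of H_0.\<close>
  have "a = 0"
    using zero[of KL 2] by (simp add: w0 single_coord_def mult_single lookup_minus)
  moreover have "b = 0"
    using zero[of KE 0] by (simp add: w0 single_coord_def wron_def mult_single lookup_double lookup_minus \<open>a = 0\<close>)
  ultimately have "w0 = 0"
    unfolding w0 by (intro coords_eqI) (simp_all add: single_coord_def)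
  then have "d (torus \<alpha>) = bracket \<alpha> u (torus \<alpha>)" by (simp add: w0_def e_def)
  with u show ?thesis by blast
qed

text \<open>A derivation killing the torus element commutes with its adjoint action and so preserves
  eigenspaces.\<close>

lemma coder_weights:
  assumes d: "coder \<alpha> p d" "d (torus \<alpha>) = 0" and "wt \<alpha> j n \<noteq> wt \<alpha> k m"
  shows "Poly_Mapping.lookup (d (unit k m) j) n = 0"
proof -
  let ?l = Poly_Mapping.lookup
  have "bracket \<alpha> (torus \<alpha>) (unit k m) = cscale (wt \<alpha> k m) (unit k m)"
    by (rule ext, rule poly_mapping_eqI)
      (auto simp: lookup_torus cscale_def lookup_single_mult single_coord_def lookup_single when_def)
  moreover have "koszul p 0 = 1" by (simp add: koszul_def)
  ultimately have "cscale (wt \<alpha> k m) (d (unit k m)) = bracket \<alpha> (torus \<alpha>) (d (unit k m))"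
    using d cpart_torus[of \<alpha>] unfolding coder_def by (metis cscale_simps(2) bracket_0(1) add_0)
  from arg_cong[OF this, of "\<lambda>x. ?l (x j) n"] show ?thesis
    using assms(3) by (simp add: lookup_torus cscale_def lookup_single_mult)
qed

section \<open>Classification of odd and of even derivations\<close>

lemma linear_coords_eqI:
  fixes d e :: "coords \<Rightarrow> coords"
  assumes "\<And>u v. d (u + v) = d u + d v" "\<And>c u. d (cscale c u) = cscale c (d u)"
    and "\<And>u v. e (u + v) = e u + e v" "\<And>c u. e (cscale c u) = cscale c (e u)"
    and "\<And>k n. d (unit k n) = e (unit k n)"
  shows "d = e"
proof
  fix u
  have *: "d (single_coord k f) = e (single_coord k f)" for k f
  proof (induction f rule: laurent_induct)
    case (single n c)
    have "single_coord k (Poly_Mapping.single n c) = cscale c (unit k n)"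
      by (rule ext) (simp add: single_coord_def cscale_def mult_single)
    then show ?case by (simp add: assms)
  next
    case (add f g)
    have "single_coord k (f + g) = single_coord k f + single_coord k g"
      by (rule ext) (simp add: single_coord_def)
    then show ?case by (simp only: assms(1,3) add)
  qed
  show "d u = e u"
    by (subst (1 2) coords_decompose) (simp only: assms(1,3) *)
qed

text \<open>Once the torus element is killed, weights are preserved; but by \<open>wt_parity\<close>
  equal weights mean equal parity, so an odd map has nothing left to do.\<close>

lemma coder_odd_inner:
  assumes d: "coder \<alpha> 1 d"
  shows "\<exists>u. cpart 1 u = u \<and> d = bracket \<alpha> u"
proof -
  obtain u where u: "cpart 1 u = u" "d (torus \<alpha>) = bracket \<alpha> u (torus \<alpha>)"
    using coder_reduce[OF d] by blast
  define e where "e v = d v - bracket \<alpha> u v" for v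
  have e: "coder \<alpha> 1 e"
    unfolding e_def using coder_diff[OF d coder_bracket[OF u(1)]] .
  have e0: "e (torus \<alpha>) = 0" by (simp add: e_def u)
  have unit: "e (unit k m) j = 0" for k m j
  proof (cases "kind_parity j = kind_parity k")
    case True
    have "cpart (kind_parity k) (unit k m) = unit k m"
      by (auto simp: cpart_eq_iff single_coord_def)
    then have "cpart (1 + kind_parity k) (e (unit k m)) = e (unit k m)"
      using e unfolding coder_def by blast
    moreover have "kind_parity j \<noteq> 1 + kind_parity k" using True by simp
    ultimately show ?thesis unfolding cpart_eq_iff by blast
  next
    case False
    then show ?thesis
      using coder_weights[OF e e0] wt_parity by (metis poly_mapping_eqI lookup_zero)
  qed
  have "e = (\<lambda>v. 0)"
    using e by (intro linear_coords_eqI) (auto simp: coder_def unit)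
  with u(1) show ?thesis unfolding e_def by (metis eq_iff_diff_eq_0 ext)
qed

text \<open>Imaginary parts separate most families. What remains are the coincidences of L_n with
  H_n and, for integral \<alpha>, of p with y.\<close>

lemma wt_eq:
  "wt \<alpha> j n = wt \<alpha> KE m \<Longrightarrow> j = KE \<and> n = m"
  "wt \<alpha> j n = wt \<alpha> KF m \<Longrightarrow> j = KF \<and> n = m"
  "wt \<alpha> j n = wt \<alpha> KL m \<Longrightarrow> j = KL \<and> n = m \<or> j = KH \<and> n = m - 1"
  "wt \<alpha> j n = wt \<alpha> KP m \<Longrightarrow> j = KP \<and> n = m \<or> j = KY \<and> \<alpha> = of_int (m - n)"
  "wt \<alpha> j n = wt \<alpha> KY m \<Longrightarrow> j = KY \<and> n = m \<or> j = KP \<and> \<alpha> = of_int (n - m)"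
  by (cases j; simp add: complex_eq_iff big_def field_simps; linarith)+

lemma cpart_single_coord: "cpart p (single_coord k f) = (if kind_parity k = p then single_coord k f else 0)"
  by (auto simp: cpart_def single_coord_def)

lemma of_int_times_single: "(of_int i :: laurent) * Poly_Mapping.single n c = Poly_Mapping.single n (of_int i * c)"
  by (simp add: mult_single single_of_int[symmetric] del: single_of_int)

text \<open>The structure constants for the even part, and the ways in which E and F generate each
  odd doublet from one element.\<close>

lemma unit_bracket:
  "bracket \<alpha> (unit KE m) (unit KF n) = unit KH (m + n)"
  "bracket \<alpha> (unit KH m) (unit KE n) = cscale 2 (unit KE (m + n))"
  "bracket \<alpha> (unit KH m) (unit KF n) = cscale (- 2) (unit KF (m + n))"
  "bracket \<alpha> (unit KH m) (unit KH n) = 0"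
  "bracket \<alpha> (unit KL m) (unit KE n) = cscale (- of_int n) (unit KE (m + n - 1))"
  "bracket \<alpha> (unit KL m) (unit KH n) = cscale (- of_int n) (unit KH (m + n - 1))"
  "bracket \<alpha> (unit KL m) (unit KF n) = cscale (- of_int n) (unit KF (m + n - 1))"
  "bracket \<alpha> (unit KL m) (unit KL n) = cscale (of_int (m - n)) (unit KL (m + n - 1))"
  "bracket \<alpha> (unit KH n) (unit KL m) = cscale (of_int n) (unit KH (m + n - 1))"
  "bracket \<alpha> (unit KE n) (unit KP 0) = unit KX n"
  "bracket \<alpha> (unit KF n) (unit KX 0) = unit KP n"
  "bracket \<alpha> (unit KE n) (unit KY 0) = unit KG n"
  "bracket \<alpha> (unit KF n) (unit KG 0) = unit KY n"
  "bracket \<alpha> (unit KX 0) (unit KY 0) = cscale (- 1) (unit KL 0) + cscale (\<alpha> / 2) (unit KH (- 1))"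
  by (rule coords_eqI; simp add: single_coord_def wron_def tderiv_def half_def cscale_def mult_single
       lookup_single single_uminus single_diff algebra_simps of_int_times_single
       flip: single_numeral)+

lemma single_coord_bracket:
  "bracket \<alpha> (unit KE n) (single_coord KY f) = single_coord KG (f * Poly_Mapping.single n 1)"
  "bracket \<alpha> (unit KF n) (single_coord KG f) = single_coord KY (f * Poly_Mapping.single n 1)"
  "bracket \<alpha> (unit KE n) (single_coord KP f) = single_coord KX (f * Poly_Mapping.single n 1)"
  "bracket \<alpha> (unit KF n) (single_coord KX f) = single_coord KP (f * Poly_Mapping.single n 1)"
  by (rule coords_eqI; simp add: single_coord_def wron_def mult.commute)+

lemma cscale_unit_inject: "cscale a (unit k n) = cscale b (unit k n) \<longleftrightarrow> a = b"
proof
  assume "cscale a (unit k n) = cscale b (unit k n)"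
  from arg_cong[OF this, of "\<lambda>u. Poly_Mapping.lookup (u k) n"] show "a = b"
    by (simp add: cscale_def lookup_single_mult single_coord_def)
qed simp

lemma additive_int_linear:
  fixes f :: "int \<Rightarrow> complex"
  assumes "\<And>m n. f (m + n) = f m + f n - f 0"
  shows "f n = f 0 + of_int n * (f 1 - f 0)"
proof (induction n rule: int_induct[where k = 0])
  case (step1 i)
  show ?case unfolding assms[of i 1] step1(2) by (simp add: algebra_simps)
next
  case (step2 i)
  have "f (i - 1) = f i - f 1 + f 0" using assms[of "i - 1" 1] by simp
  then show ?case unfolding step2(2) by (simp add: algebra_simps)
qed simp

lemma lookup_tw:
  "Poly_Mapping.lookup (tw \<alpha>) n = (if \<alpha> = of_int n then 1 else 0)"
  "Poly_Mapping.lookup (tw_inv \<alpha>) n = (if \<alpha> = of_int (- n) then 1 else 0)"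
  by (auto simp: tw_def tw_inv_def lookup_single when_def simp flip: of_int_minus
      elim!: Ints_cases)

text \<open>The derivation is first made zero on the even part by subtracting inner derivations. It
  then commutes with all E_n and F_n, and two values, on one element of each odd doublet, determine
  a 2 by 2 matrix.\<close>

lemma coder_even:
  assumes d: "coder \<alpha> 0 d"
  shows "\<exists>u m. cpart 0 u = u \<and> trace m = 0 \<and> (\<alpha> \<in> \<int> \<or> m $ 1 $ 2 = 0 \<and> m $ 2 $ 1 = 0) \<and>
    d = (\<lambda>v. bracket \<alpha> u v + outer \<alpha> m v)"
proof -
  let ?l = Poly_Mapping.lookup
  have leib: "e (bracket \<alpha> (unit k m) v) = bracket \<alpha> (e (unit k m)) v + bracket \<alpha> (unit k m) (e v)"
    if "coder \<alpha> 0 e" for e k m v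
  proof -
    have "cpart (kind_parity k) (unit k m) = unit k m"
      by (auto simp: cpart_eq_iff single_coord_def)
    moreover have "koszul 0 q = 1" for q by (simp add: koszul_def)
    ultimately show ?thesis
      using that unfolding coder_def by (metis cscale_simps(2))
  qed
  obtain u where u: "cpart 0 u = u" "d (torus \<alpha>) = bracket \<alpha> u (torus \<alpha>)"
    using coder_reduce[OF d] by blast
  define e where "e v = d v - bracket \<alpha> u v" for v
  have e: "coder \<alpha> 0 e"
    unfolding e_def using coder_diff[OF d coder_bracket[OF u(1)]] .
  have e0: "e (torus \<alpha>) = 0" by (simp add: e_def u)
  have e_scale: "e (cscale c v) = cscale c (e v)" for c v using e by (simp add: coder_def)
  have e_add: "e (v + w) = e v + e w" for v w using e by (simp add: coder_def)
  have e_uminus: "e (- v) = - e v" for v using e_scale[of "- 1" v] by simp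
  define ce where "ce m = ?l (e (unit KE m) KE) m" for m
  define cf where "cf m = ?l (e (unit KF m) KF) m" for m
  define l where "l m = ?l (e (unit KL m) KL) m" for m
  define b where "b m = ?l (e (unit KL m) KH) (m - 1)" for m
  note weights = coder_weights[OF e e0]
  \<comment> \<open>The weights of E and F are simple, so \<open>e\<close> is diagonal
    there.\<close>
  have E: "e (unit KE m) = cscale (ce m) (unit KE m)" for m
    using weights[where k = KE and m = m] wt_eq(1)[where \<alpha> = \<alpha> and m = m]
    by (intro ext poly_mapping_eqI)
      (auto simp: cscale_def lookup_single_mult single_coord_def lookup_single when_def ce_def)
  have F: "e (unit KF m) = cscale (cf m) (unit KF m)" for m
    using weights[where k = KF and m = m] wt_eq(2)[where \<alpha> = \<alpha> and m = m]
    by (intro ext poly_mapping_eqI)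
      (auto simp: cscale_def lookup_single_mult single_coord_def lookup_single when_def cf_def)
  have L: "e (unit KL m) = cscale (l m) (unit KL m) + cscale (b m) (unit KH (m - 1))" for m
  proof -
    have "?l (e (unit KL m) j) n = 0" if "\<not> (j = KL \<and> n = m \<or> j = KH \<and> n = m - 1)" for j n
      using weights wt_eq(3) that by blast
    then show ?thesis
      by (intro ext poly_mapping_eqI)
        (auto simp: cscale_def lookup_single_mult single_coord_def lookup_single lookup_add when_def
          l_def b_def)
  qed
  \<comment> \<open>H_{m+n} is [E_m, F_n] for every splitting of its index, so the resulting factor
    depends on m + n only.\<close>
  have H: "e (unit KH (m + n)) = cscale (ce m + cf n) (unit KH (m + n))" for m n
    using leib[OF e, of KE m "unit KF n"]
    by (simp add: unit_bracket E F bracket_scale)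
      (simp add: cscale_def single_add fun_eq_iff algebra_simps)
  have 1: "ce m + cf n = ce (m + n) + cf 0" for m n
    using H[of m n] H[of "m + n" 0] by (simp add: cscale_unit_inject)
  have 2: "ce (m + n) = ce m + cf 0 + ce n" for m n
  proof -
    have "cscale (2 * ce (m + n)) (unit KE (m + n)) =
        cscale (2 * (ce m + cf 0)) (unit KE (m + n)) + cscale (2 * ce n) (unit KE (m + n))"
      using leib[OF e, of KH m "unit KE n"] H[of m 0]
      by (simp add: unit_bracket E bracket_scale e_scale mult.commute)
    also have "\<dots> = cscale (2 * (ce m + cf 0 + ce n)) (unit KE (m + n))"
      by (simp add: cscale_def single_add fun_eq_iff algebra_simps)
    finally have "2 * ce (m + n) = 2 * (ce m + cf 0 + ce n)"
      by (simp only: cscale_unit_inject)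
    then show ?thesis by (metis mult_left_cancel zero_neq_numeral)
  qed
  have cf0: "cf 0 = - ce 0" using 2[of 0 0] by (simp add: eq_neg_iff_add_eq_0 add.commute)
  define s where "s = ce 1 - ce 0"
  have ce: "ce n = ce 0 + of_int n * s" for n
    unfolding s_def by (rule additive_int_linear) (simp add: 2 cf0)
  have cf: "cf n = of_int n * s - ce 0" for n
    using 1[of 0 n] ce[of n] cf0 by (simp add: eq_diff_eq add.commute)
  have L': "b m = 0 \<and> l m = of_int (m - 1) * s" for m
  proof -
    \<comment> \<open>Apply \<open>e\<close> to [L_{m-1}, E_n]. The case n = 0 gives b = 0, after
      which n = 1 gives l.\<close>
    have *: "- of_int n * ce (m + n - 1) = - of_int n * l m + 2 * b m - of_int n * ce n" for n
    proof -
      have "cscale (- of_int n * ce (m + n - 1)) (unit KE (m + n - 1)) =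
          cscale (- of_int n * l m) (unit KE (m + n - 1)) + cscale (2 * b m) (unit KE (m + n - 1))
          + cscale (- of_int n * ce n) (unit KE (m + n - 1))"
        using leib[OF e, of KL m "unit KE n"]
        by (simp add: unit_bracket E L bracket_scale bracket_add e_scale e_uminus algebra_simps)
      also have "\<dots> = cscale (- of_int n * l m + 2 * b m - of_int n * ce n) (unit KE (m + n - 1))"
        by (simp add: cscale_def single_add single_diff single_uminus fun_eq_iff algebra_simps)
      finally show ?thesis by (simp only: cscale_unit_inject)
    qed
    have "b m = 0" using *[of 0] by simp
    moreover have "ce m = l m + ce 1"
      using *[of 1] \<open>b m = 0\<close> by (simp flip: minus_add_distrib neg_equal_iff_equal[of "ce m"])
    ultimately show ?thesis by (simp add: ce[of m] ce[of 1] algebra_simps)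
  qed
  \<comment> \<open>L_0 multiplies E_n by -n and H_0 multiplies it by 2. This combination therefore
    acts on E_n by ce 0 + n s, and on F_n by n s - ce 0.\<close>
  define u2 where "u2 = cscale (- s) (unit KL 1) + cscale (ce 0 / 2) (unit KH 0)"
  have u2: "cpart 0 u2 = u2"
    unfolding u2_def cpart_simps cpart_single_coord by simp
  define e2 where "e2 v = e v - bracket \<alpha> u2 v" for v
  have e2: "coder \<alpha> 0 e2"
    unfolding e2_def using coder_diff[OF e coder_bracket[OF u2]] .
  have e2_scale: "e2 (cscale c v) = cscale c (e2 v)" for c v using e2 by (simp add: coder_def)
  have e2_add: "e2 (v + w) = e2 v + e2 w" for v w using e2 by (simp add: coder_def)
  have even: "e2 (unit KL n) = 0" "e2 (unit KE n) = 0" "e2 (unit KH n) = 0" "e2 (unit KF n) = 0" for n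
    unfolding e2_def u2_def bracket_add bracket_scale unit_bracket L H[of n 0, simplified] E F
    by (intro ext poly_mapping_eqI;
        simp add: cscale_def lookup_single_mult lookup_add lookup_minus single_coord_def lookup_single
          when_def lookup_double L'[of n] ce[of n] cf[of n] cf0 algebra_simps)+
  have e20: "e2 (torus \<alpha>) = 0"
  proof -
    have "torus \<alpha> = unit KL 1 + cscale (big \<alpha>) (unit KH 0)"
      by (rule coords_eqI) (simp_all add: torus_def single_coord_def cscale_def)
    then show ?thesis using even(3)[of 0] by (simp add: e2_add e2_scale even)
  qed
  \<comment> \<open>Otherwise the monomial in \<open>unit k 0\<close> would be rewritten to 1 and
    the rules about \<open>unit\<close> would not match.\<close>
  note [simp del] = single_one
  note weights2 = coder_weights[OF e2 e20]
  define A where "A = ?l (e2 (unit KP 0) KP) 0"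
  define C where "C = ?l (e2 (unit KY 0) KY) 0"
  \<comment> \<open>For integral \<alpha> the weight of p_{-1} is shared with y_{-\<alpha>} and that
    of y_0 with p_{\<alpha>-1}. Otherwise both weight spaces are lines and no mixing occurs.\<close>
  define B where "B = (if \<alpha> \<in> \<int> then ?l (e2 (unit KP 0) KY) (- \<lfloor>Re \<alpha>\<rfloor>) else 0)"
  define D where "D = (if \<alpha> \<in> \<int> then ?l (e2 (unit KY 0) KP) \<lfloor>Re \<alpha>\<rfloor> else 0)"
  have P: "e2 (unit KP 0) = cscale A (unit KP 0) + single_coord KY (const B * tw_inv \<alpha>)"
  proof (intro ext poly_mapping_eqI)
    fix j n
    have "?l (e2 (unit KP 0) j) n = 0" if "\<not> (j = KP \<and> n = 0 \<or> j = KY \<and> \<alpha> = of_int (- n))"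
      using weights2 wt_eq(4)[where m = 0] that by (metis diff_0)
    moreover have "B = ?l (e2 (unit KP 0) KY) n" if "\<alpha> = of_int (- n)"
      using that by (simp add: B_def)
    ultimately show "?l (e2 (unit KP 0) j) n =
        ?l ((cscale A (unit KP 0) + single_coord KY (const B * tw_inv \<alpha>)) j) n"
      by (cases "j = KP \<and> n = 0 \<or> j = KY \<and> \<alpha> = of_int (- n)")
        (auto simp: cscale_def lookup_single_mult single_coord_def lookup_single lookup_add when_def
          A_def lookup_tw)
  qed
  have Y: "e2 (unit KY 0) = cscale C (unit KY 0) + single_coord KP (const D * tw \<alpha>)"
  proof (intro ext poly_mapping_eqI)
    fix j n
    have "?l (e2 (unit KY 0) j) n = 0" if "\<not> (j = KY \<and> n = 0 \<or> j = KP \<and> \<alpha> = of_int n)"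
      using weights2 wt_eq(5)[where m = 0] that by (metis diff_zero)
    moreover have "D = ?l (e2 (unit KY 0) KP) n" if "\<alpha> = of_int n"
      using that by (simp add: D_def)
    ultimately show "?l (e2 (unit KY 0) j) n =
        ?l ((cscale C (unit KY 0) + single_coord KP (const D * tw \<alpha>)) j) n"
      by (cases "j = KY \<and> n = 0 \<or> j = KP \<and> \<alpha> = of_int n")
        (auto simp: cscale_def lookup_single_mult single_coord_def lookup_single lookup_add when_def
          C_def lookup_tw)
  qed
  \<comment> \<open>As \<open>e2\<close> kills E_n and F_n, it commutes with bracketing by them; the
    values on p_{-1} and y_0 spread over both doublets.\<close>
  have X: "e2 (unit KX n) = cscale A (unit KX n) + single_coord KG (const B * tw_inv \<alpha> * Poly_Mapping.single n 1)" for n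
    using leib[OF e2, of KE n "unit KP 0"]
    by (simp add: unit_bracket even P bracket_add bracket_scale single_coord_bracket mult_single mult.assoc)
  have G: "e2 (unit KG n) = cscale C (unit KG n) + single_coord KX (const D * tw \<alpha> * Poly_Mapping.single n 1)" for n
    using leib[OF e2, of KE n "unit KY 0"]
    by (simp add: unit_bracket even Y bracket_add bracket_scale single_coord_bracket mult_single mult.assoc)
  have P': "e2 (unit KP n) = cscale A (unit KP n) + single_coord KY (const B * tw_inv \<alpha> * Poly_Mapping.single n 1)" for n
    using leib[OF e2, of KF n "unit KX 0"]
    by (simp add: unit_bracket even X bracket_add bracket_scale single_coord_bracket mult_single mult.assoc)
  have Y': "e2 (unit KY n) = cscale C (unit KY n) + single_coord KP (const D * tw \<alpha> * Poly_Mapping.single n 1)" for n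
    using leib[OF e2, of KF n "unit KG 0"]
    by (simp add: unit_bracket even G bracket_add bracket_scale single_coord_bracket mult_single mult.assoc)
  \<comment> \<open>[x_{-1}, y_0] is even and hence killed. The L coordinate of this equation is the
    trace condition A + C = 0.\<close>
  have "bracket \<alpha> (e2 (unit KX 0)) (unit KY 0) + bracket \<alpha> (unit KX 0) (e2 (unit KY 0)) = 0"
  proof -
    have "e2 (bracket \<alpha> (unit KX 0) (unit KY 0)) = 0"
      unfolding unit_bracket e2_add e2_scale even by simp
    then show ?thesis by (simp only: leib[OF e2])
  qed
  from arg_cong[OF this[unfolded X Y], of "\<lambda>v. v KL"] have "const (A + C) = 0"
    by (simp add: single_coord_def cscale_def single_add single_one)
      (simp add: add_eq_0_iff2 neg_eq_iff_add_eq_0)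
  then have C: "C = - A"
    by (metis add_eq_0_iff lookup_single_eq lookup_zero)
  define m :: "complex^2^2" where "m = vector [vector [A, D], vector [B, - A]]"
  have m: "m $ 1 $ 1 = A" "m $ 1 $ 2 = D" "m $ 2 $ 1 = B" "m $ 2 $ 2 = - A"
    by (simp_all add: m_def)
  have "e2 = outer \<alpha> m"
  proof (rule linear_coords_eqI)
    fix k n
    show "e2 (unit k n) = outer \<alpha> m (unit k n)"
    proof (cases "kind_parity k = 0")
      case True
      then show ?thesis
        by (cases k; simp add: even; intro coords_eqI; simp add: outer_def single_coord_def)
    next
      case False
      then show ?thesis
        by (cases k; simp add: X P' G Y' C; intro coords_eqI;
            simp add: outer_def single_coord_def cscale_def m single_uminus)
    qed
  qed (simp_all add: e2_add e2_scale)
  then have "d v = bracket \<alpha> (u + u2) v + outer \<alpha> m v" for v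
    by (simp add: bracket_add e2_def e_def fun_eq_iff algebra_simps)
  moreover have "cpart 0 (u + u2) = u + u2" by (simp add: u(1) u2)
  moreover have "trace m = 0" by (simp add: trace_2 m)
  moreover have "\<alpha> \<in> \<int> \<or> m $ 1 $ 2 = 0 \<and> m $ 2 $ 1 = 0" by (auto simp: m B_def D_def)
  ultimately show ?thesis by blast
qed

section \<open>Quotients of semidirect products\<close>

text \<open>Elements of A are written \<rho> u m, and I consists of those with m = 0. By additivity
  the coset of \<rho> u m is the set of all \<rho> v m, so only the m component survives. The other
  operations need their u component merely to exist.\<close>

lemma superalgebra_iso_quotient:
  fixes A :: "('a, 'm) superalgebra_scheme" and B :: "('b, 'n) superalgebra_scheme"
    and \<rho> :: "'u::ab_group_add \<Rightarrow> 'b \<Rightarrow> 'a"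
  assumes carrier: "scarrier A = (\<Union>m\<in>scarrier B. range (\<lambda>u. \<rho> u m))"
    and inj: "\<And>u v m n. m \<in> scarrier B \<Longrightarrow> n \<in> scarrier B \<Longrightarrow> \<rho> u m = \<rho> v n \<Longrightarrow> m = n"
    and I: "I = range (\<lambda>u. \<rho> u (szero B))"
    and B: "szero B \<in> scarrier B" "\<And>m. m \<in> scarrier B \<Longrightarrow> splus B m (szero B) = m"
      "\<And>m n. m \<in> scarrier B \<Longrightarrow> n \<in> scarrier B \<Longrightarrow> splus B m n \<in> scarrier B"
      "\<And>c m. m \<in> scarrier B \<Longrightarrow> sscale B c m \<in> scarrier B"
      "\<And>m n. m \<in> scarrier B \<Longrightarrow> n \<in> scarrier B \<Longrightarrow> sprod B m n \<in> scarrier B"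
      "\<And>p m. m \<in> scarrier B \<Longrightarrow> spart B p m \<in> scarrier B"
    and plus: "\<And>u v m n. m \<in> scarrier B \<Longrightarrow> n \<in> scarrier B \<Longrightarrow>
      splus A (\<rho> u m) (\<rho> v n) = \<rho> (u + v) (splus B m n)"
    and scale: "\<And>c u m. m \<in> scarrier B \<Longrightarrow> \<exists>w. sscale A c (\<rho> u m) = \<rho> w (sscale B c m)"
    and prod: "\<And>u v m n. m \<in> scarrier B \<Longrightarrow> n \<in> scarrier B \<Longrightarrow>
      \<exists>w. sprod A (\<rho> u m) (\<rho> v n) = \<rho> w (sprod B m n)"
    and part: "\<And>p u m. m \<in> scarrier B \<Longrightarrow> \<exists>w. spart A p (\<rho> u m) = \<rho> w (spart B p m)"
  shows "(\<lambda>m. coset A I (\<rho> 0 m)) \<in> superalgebra_iso B (quotient A I)"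
proof -
  define K where "K m = range (\<lambda>u. \<rho> u m)" for m
  have coset: "coset A I (\<rho> u m) = K m" if m: "m \<in> scarrier B" for u m
  proof -
    have "coset A I (\<rho> u m) = range (\<lambda>v. \<rho> (u + v) m)"
      using plus[OF m B(1)] B(2)[OF m] by (simp add: coset_def I image_image)
    also have "\<dots> = K m"
    proof (intro equalityI subsetI)
      fix x assume "x \<in> K m"
      then obtain w where "x = \<rho> w m" by (auto simp: K_def)
      then have "x = \<rho> (u + (w - u)) m" by simp
      then show "x \<in> range (\<lambda>v. \<rho> (u + v) m)" by (rule range_eqI)
    qed (auto simp: K_def)
    finally show ?thesis .
  qed
  have K_mem: "\<exists>u. x = \<rho> u m" if "x \<in> K m" for x m
    using that by (auto simp: K_def)
  have K_ne: "\<rho> 0 m \<in> K m" for m by (auto simp: K_def)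
  have K_inj: "m = n" if "m \<in> scarrier B" "n \<in> scarrier B" "K m = K n" for m n
    using K_ne[of m] K_mem[of "\<rho> 0 m" n] inj[OF that(1,2)] that(3) by auto
  have car: "scarrier (quotient A I) = K ` scarrier B"
  proof -
    have "coset A I ` scarrier A = (\<Union>m\<in>scarrier B. (\<lambda>u. coset A I (\<rho> u m)) ` UNIV)"
      unfolding carrier by blast
    also have "\<dots> = K ` scarrier B" by (auto simp: coset)
    finally show ?thesis by (simp add: quotient_def)
  qed
  have plus': "splus (quotient A I) (K m) (K n) = K (splus B m n)"
    if "m \<in> scarrier B" "n \<in> scarrier B" for m n
  proof -
    have "coset A I (splus A x y) = K (splus B m n)" if "x \<in> K m" "y \<in> K n" for x y
      using K_mem[OF that(1)] K_mem[OF that(2)] plus coset B(3) \<open>m \<in> _\<close> \<open>n \<in> _\<close> by auto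
    then show ?thesis using K_ne[of m] K_ne[of n] by (auto simp: quotient_def)
  qed
  have prod': "sprod (quotient A I) (K m) (K n) = K (sprod B m n)"
    if "m \<in> scarrier B" "n \<in> scarrier B" for m n
  proof -
    have "coset A I (sprod A x y) = K (sprod B m n)" if "x \<in> K m" "y \<in> K n" for x y
      using K_mem[OF that(1)] K_mem[OF that(2)] prod coset B(5) \<open>m \<in> _\<close> \<open>n \<in> _\<close> by metis
    then show ?thesis using K_ne[of m] K_ne[of n] by (auto simp: quotient_def)
  qed
  have scale': "sscale (quotient A I) c (K m) = K (sscale B c m)" if "m \<in> scarrier B" for c m
  proof -
    have "coset A I (sscale A c x) = K (sscale B c m)" if "x \<in> K m" for x
      using K_mem[OF that] scale coset B(4) \<open>m \<in> _\<close> by metis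
    then show ?thesis using K_ne[of m] by (auto simp: quotient_def)
  qed
  have part': "spart (quotient A I) p (K m) = K (spart B p m)" if "m \<in> scarrier B" for p m
  proof -
    have "coset A I (spart A p x) = K (spart B p m)" if "x \<in> K m" for x
      using K_mem[OF that] part coset B(6) \<open>m \<in> _\<close> by metis
    then show ?thesis using K_ne[of m] by (auto simp: quotient_def)
  qed
  show ?thesis
    unfolding superalgebra_iso_def
    using K_inj by (auto simp: bij_betw_def inj_on_def car coset B plus' prod' scale' part')
qed

lemma sspan_superalgebra_iso:
  assumes \<phi>: "\<phi> \<in> superalgebra_iso B X" and zero: "szero X = \<phi> (szero B)"
    and closed: "ssubspace B (scarrier B)" and span: "scarrier B = sspan B G" and G: "G \<subseteq> scarrier B"
  shows "scarrier X = sspan X (\<phi> ` G)"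
proof
  have bij: "\<phi> ` scarrier B = scarrier X"
    using \<phi> by (auto simp: superalgebra_iso_def bij_betw_def)
  have plus: "\<phi> (splus B x y) = splus X (\<phi> x) (\<phi> y)" if "x \<in> scarrier B" "y \<in> scarrier B" for x y
    using \<phi> that by (auto simp: superalgebra_iso_def)
  have scale: "\<phi> (sscale B c x) = sscale X c (\<phi> x)" if "x \<in> scarrier B" for c x
    using \<phi> that by (auto simp: superalgebra_iso_def)
  have "ssubspace X (scarrier X)"
    using closed unfolding ssubspace_def bij[symmetric] zero
    by (auto simp flip: plus scale)
  moreover have "\<phi> ` G \<subseteq> scarrier X" using G bij by blast
  ultimately show "sspan X (\<phi> ` G) \<subseteq> scarrier X" unfolding sspan_def by blast
  show "scarrier X \<subseteq> sspan X (\<phi> ` G)"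
    unfolding sspan_def
  proof (intro subsetI InterI, clarify)
    fix x V assume x: "x \<in> scarrier X" and V: "ssubspace X V" "\<phi> ` G \<subseteq> V"
    have "ssubspace B {b \<in> scarrier B. \<phi> b \<in> V}"
      using closed V(1) unfolding ssubspace_def by (auto simp: plus scale simp flip: zero)
    then have "sspan B G \<subseteq> {b \<in> scarrier B. \<phi> b \<in> V}"
      unfolding sspan_def using V(2) G by blast
    moreover obtain b where "b \<in> scarrier B" "x = \<phi> b" using x bij by auto
    ultimately show "x \<in> V" using span by auto
  qed
qed

section \<open>Derivations of S'(2,\<alpha>)\<close>

text \<open>Transport along \<open>field\<close>, restricted to the carrier because superderivations
  are required to be \<open>undefined\<close> outside it.\<close>

definition lift :: "complex \<Rightarrow> (coords \<Rightarrow> coords) \<Rightarrow> (sfun \<Rightarrow> sfun) \<Rightarrow> sfun \<Rightarrow> sfun" where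
  "lift \<alpha> d = (\<lambda>x\<in>scarrier (S2' \<alpha>). field \<alpha> (d (inv (field \<alpha>) x)))"

lemma inj_field: "inj (field \<alpha>)"
  by (auto intro: injI simp: field_inject)

lemma lift_field [simp]: "lift \<alpha> d (field \<alpha> u) = field \<alpha> (d u)"
  by (simp add: lift_def S2'_carrier inv_f_f[OF inj_field])

lemma lift_eqI:
  assumes "\<And>u. D (field \<alpha> u) = field \<alpha> (d u)" "D \<in> extensional (scarrier (S2' \<alpha>))"
  shows "D = lift \<alpha> d"
proof (rule extensionalityI[OF assms(2)])
  show "lift \<alpha> d \<in> extensional (scarrier (S2' \<alpha>))" by (simp add: lift_def)
qed (auto simp: S2'_carrier assms(1))

lemma lift_inject: "lift \<alpha> d = lift \<alpha> e \<longleftrightarrow> d = e"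
proof
  assume "lift \<alpha> d = lift \<alpha> e"
  then show "d = e" by (metis lift_field field_inject ext)
qed simp

lemma field_mem [simp]: "field \<alpha> u \<in> scarrier (S2' \<alpha>)"
  by (simp add: S2'_carrier)

lemma field_plus: "op_plus sfun_algebra (field \<alpha> u) (field \<alpha> v) = field \<alpha> (u + v)"
  by (simp add: field_of_add)

lemma field_sscale: "op_scale sfun_algebra c (field \<alpha> u) = field \<alpha> (cscale c u)"
  by (simp add: field_scale)

lemmas field_ops = field_plus field_sscale field_bracket field_part

lemma lift_ops:
  "op_plus (S2' \<alpha>) (lift \<alpha> d) (lift \<alpha> e) = lift \<alpha> (\<lambda>u. d u + e u)"
  "op_scale (S2' \<alpha>) c (lift \<alpha> d) = lift \<alpha> (\<lambda>u. cscale c (d u))"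
  "op_comp (S2' \<alpha>) (lift \<alpha> d) (lift \<alpha> e) = lift \<alpha> (\<lambda>u. d (e u))"
  "op_part (S2' \<alpha>) p (lift \<alpha> d) = lift \<alpha> (\<lambda>u. cpart p (d (cpart 0 u)) + cpart (p + 1) (d (cpart 1 u)))"
  unfolding op_plus_def[of "S2' \<alpha>"] op_scale_def[of "S2' \<alpha>"] op_comp_def op_part_def[of "S2' \<alpha>"] S2'_simps
  by (rule lift_eqI;
      simp only: restrict_apply field_mem if_True lift_field field_ops restrict_extensional)+

lemma homogeneous_S2': "homogeneous (S2' \<alpha>) q = field \<alpha> ` {u. cpart q u = u}"
  by (auto simp: homogeneous_def S2'_carrier field_part field_inject)

lemma superder_S2': "superder (S2' \<alpha>) p = lift \<alpha> ` {d. coder \<alpha> p d}"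
proof (intro equalityI subsetI)
  fix D assume D: "D \<in> superder (S2' \<alpha>) p"
  define d where "d u = inv (field \<alpha>) (D (field \<alpha> u))" for u
  have range: "D (field \<alpha> u) \<in> range (field \<alpha>)" for u
    using D by (auto simp: superder_def S2'_carrier)
  have Dd: "D (field \<alpha> u) = field \<alpha> (d u)" for u
    unfolding d_def f_inv_into_f[OF range] ..
  have "D \<in> extensional (scarrier (S2' \<alpha>))"
    using D by (auto simp: superder_def PiE_def)
  with Dd have "D = lift \<alpha> d" by (rule lift_eqI)
  moreover have "coder \<alpha> p d"
    using D unfolding superder_def coder_def homogeneous_S2'
    by (simp add: S2'_carrier field_ops Dd field_inject inj_image_mem_iff[OF inj_field])
  ultimately show "D \<in> lift \<alpha> ` {d. coder \<alpha> p d}" by blast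
next
  fix D assume "D \<in> lift \<alpha> ` {d. coder \<alpha> p d}"
  then obtain d where D: "D = lift \<alpha> d" and d: "coder \<alpha> p d" by blast
  have "D \<in> scarrier (S2' \<alpha>) \<rightarrow>\<^sub>E scarrier (S2' \<alpha>)"
    unfolding D lift_def by (auto simp del: S2'_carrier)
  then show "D \<in> superder (S2' \<alpha>) p"
    using d unfolding superder_def coder_def homogeneous_S2'
    by (simp add: S2'_carrier field_ops D field_inject inj_image_mem_iff[OF inj_field])
qed

section \<open>The derivation algebra as inner derivations extended by matrices\<close>

definition der_of :: "complex \<Rightarrow> coords \<Rightarrow> complex^2^2 \<Rightarrow> (sfun \<Rightarrow> sfun) \<Rightarrow> sfun \<Rightarrow> sfun" where
  "der_of \<alpha> u m = lift \<alpha> (\<lambda>v. bracket \<alpha> u v + outer \<alpha> m v)"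

text \<open>All of sl(2) for integral \<alpha> and its diagonal otherwise, so that both cases of the
  theorem are treated together.\<close>

definition outer_sl2 :: "complex \<Rightarrow> (complex^2^2) superalgebra" where
  "outer_sl2 \<alpha> = sl2\<lparr>scarrier := {m. trace m = 0 \<and> (\<alpha> \<in> \<int> \<or> m $ 1 $ 2 = 0 \<and> m $ 2 $ 1 = 0)}\<rparr>"

lemma outer_0 [simp]: "outer \<alpha> 0 u = 0" "outer \<alpha> m 0 = 0"
  by (rule coords_eqI; simp add: outer_def)+

lemma bit_add_self: "r + q + q = (r :: bit)"
  using bit_cases[of r] bit_cases[of q] by auto

text \<open>Parities add under the bracket, and p + q is p - q modulo 2: only this component of u
  takes parity q to parity p.\<close>

lemma cpart_bracket_right: "cpart p (bracket \<alpha> u (cpart q v)) = bracket \<alpha> (cpart (p + q) u) (cpart q v)"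
proof -
  have other: "cpart p w = 0" if "cpart r w = w" "r \<noteq> p" for r w
    using that by (auto simp: cpart_eq_iff) (auto simp: cpart_def fun_eq_iff)
  have self: "cpart r (bracket \<alpha> (cpart (r + q) u) (cpart q v)) = bracket \<alpha> (cpart (r + q) u) (cpart q v)" for r
    using cpart_bracket[of "r + q" "cpart (r + q) u" q "cpart q v" \<alpha>]
    by (simp only: cpart_simps bit_add_self)
  have "u = cpart (p + q) u + cpart (p + 1 + q) u"
    using bit_cases[of p] bit_cases[of q] by auto
  then have "bracket \<alpha> u (cpart q v) =
      bracket \<alpha> (cpart (p + q) u) (cpart q v) + bracket \<alpha> (cpart (p + 1 + q) u) (cpart q v)"
    by (metis bracket_add(2))
  then show ?thesis
    using self[of p] other[OF self[of "p + 1"]] by simp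
qed

lemma der_of_part:
  "op_part (S2' \<alpha>) p (der_of \<alpha> u m) = der_of \<alpha> (cpart p u) (if p = 0 then m else 0)"
proof -
  have *: "cpart p (cpart q v) = (if p = q then cpart q v else 0)" for p q v
    by (auto simp: cpart_def)
  have outer: "cpart r (outer \<alpha> m (cpart q v)) = (if r = q then outer \<alpha> m (cpart q v) else 0)" for r q v
    by (simp add: * flip: outer_cpart)
  show ?thesis
    unfolding der_of_def lift_ops lift_inject
  proof
    fix v
    have split: "bracket \<alpha> (cpart p u) v = bracket \<alpha> (cpart p u) (cpart 0 v) + bracket \<alpha> (cpart p u) (cpart 1 v)"
      "outer \<alpha> m v = outer \<alpha> m (cpart 0 v) + outer \<alpha> m (cpart 1 v)"
      by (simp_all flip: bracket_add(1) outer_linear(1))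
    show "cpart p (bracket \<alpha> u (cpart 0 v) + outer \<alpha> m (cpart 0 v)) +
        cpart (p + 1) (bracket \<alpha> u (cpart 1 v) + outer \<alpha> m (cpart 1 v)) =
        bracket \<alpha> (cpart p u) v + outer \<alpha> (if p = 0 then m else 0) v"
      using bit_cases[of p] split
      by (auto simp: cpart_bracket_right outer)
  qed
qed

lemma der_of_plus:
  "op_plus (S2' \<alpha>) (der_of \<alpha> u m) (der_of \<alpha> v n) = der_of \<alpha> (u + v) (m + n)"
  unfolding der_of_def lift_ops lift_inject by (simp add: bracket_add fun_eq_iff algebra_simps)

lemma der_of_scale:
  "op_scale (S2' \<alpha>) c (der_of \<alpha> u m) = der_of \<alpha> (cscale c u) (\<chi> i j. c * m $ i $ j)"
  unfolding der_of_def lift_ops lift_inject by (simp only: bracket_scale outer_linear cscale_simps)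

lemma coder_add:
  assumes "coder \<alpha> p d" "coder \<alpha> p e"
  shows "coder \<alpha> p (\<lambda>u. d u + e u)"
  using assms by (simp add: coder_def bracket_add)

lemma der_of_mem:
  assumes "m \<in> scarrier (outer_sl2 \<alpha>)"
  shows "der_of \<alpha> u m \<in> scarrier (Der (S2' \<alpha>))"
proof -
  have m: "trace m = 0" using assms by (simp add: outer_sl2_def)
  have "coder \<alpha> 0 (\<lambda>v. bracket \<alpha> (cpart 0 u) v + outer \<alpha> m v)"
    by (intro coder_add coder_bracket coder_outer m) simp
  moreover have "coder \<alpha> 1 (bracket \<alpha> (cpart 1 u))"
    by (intro coder_bracket) simp
  moreover have "der_of \<alpha> u m = op_plus (S2' \<alpha>)
      (lift \<alpha> (\<lambda>v. bracket \<alpha> (cpart 0 u) v + outer \<alpha> m v)) (lift \<alpha> (bracket \<alpha> (cpart 1 u)))"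
  proof -
    have "bracket \<alpha> u v = bracket \<alpha> (cpart 0 u) v + bracket \<alpha> (cpart 1 u) v" for v
      by (simp flip: bracket_add(2))
    then show ?thesis
      unfolding der_of_def lift_ops lift_inject by (simp add: fun_eq_iff algebra_simps)
  qed
  ultimately show ?thesis unfolding Der_def superder_S2' by auto
qed

lemma Der_S2'_carrier:
  "scarrier (Der (S2' \<alpha>)) = (\<Union>m\<in>scarrier (outer_sl2 \<alpha>). range (\<lambda>u. der_of \<alpha> u m))"
proof (intro equalityI subsetI)
  fix D assume "D \<in> scarrier (Der (S2' \<alpha>))"
  then obtain d0 d1 where D: "D = op_plus (S2' \<alpha>) (lift \<alpha> d0) (lift \<alpha> d1)"
    and d: "coder \<alpha> 0 d0" "coder \<alpha> 1 d1"
    by (auto simp: Der_def superder_S2')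
  obtain u m where d0: "trace m = 0" "\<alpha> \<in> \<int> \<or> m $ 1 $ 2 = 0 \<and> m $ 2 $ 1 = 0"
      "d0 = (\<lambda>v. bracket \<alpha> u v + outer \<alpha> m v)"
    using coder_even[OF d(1)] by blast
  obtain v where d1: "d1 = bracket \<alpha> v" using coder_odd_inner[OF d(2)] by blast
  have "D = der_of \<alpha> (u + v) m"
    unfolding D der_of_def lift_ops lift_inject d0 d1 by (simp add: bracket_add fun_eq_iff algebra_simps)
  moreover have "m \<in> scarrier (outer_sl2 \<alpha>)" using d0 by (simp add: outer_sl2_def)
  ultimately show "D \<in> (\<Union>m\<in>scarrier (outer_sl2 \<alpha>). range (\<lambda>u. der_of \<alpha> u m))" by blast
next
  fix D assume "D \<in> (\<Union>m\<in>scarrier (outer_sl2 \<alpha>). range (\<lambda>u. der_of \<alpha> u m))"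
  then show "D \<in> scarrier (Der (S2' \<alpha>))" using der_of_mem by blast
qed

text \<open>Matrices act as zero on the even part, so the difference of the inner parts centralizes
  it. This centralizer is trivial, and the matrix entries can then be read off.\<close>

lemma der_of_inject:
  assumes "m \<in> scarrier (outer_sl2 \<alpha>)" "n \<in> scarrier (outer_sl2 \<alpha>)"
    and eq: "der_of \<alpha> u m = der_of \<alpha> v n"
  shows "m = n"
proof -
  define w where "w = u - v"
  have *: "bracket \<alpha> w x = outer \<alpha> n x - outer \<alpha> m x" for x
    using eq unfolding der_of_def lift_inject w_def
    by (simp add: bracket_diff fun_eq_iff algebra_simps)
  have even: "bracket \<alpha> w (single_coord k f) = 0" if "kind_parity k = 0" for k f
    using that unfolding * by (cases k; intro coords_eqI; simp add: outer_def single_coord_def)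
  \<comment> \<open>H_0 has eigenvalues \<plusminus>2 or \<plusminus>1 on these six families. E_0
    and then E_1 dispose of the remaining two.\<close>
  have w1: "w KE = 0" "w KF = 0" "w KX = 0" "w KP = 0" "w KG = 0" "w KY = 0"
    using fun_cong[OF even[of KH 1]] laurent_double_cancel[of _ 0]
    by (force simp: single_coord_def wron_def dest: spec[of _ KE] spec[of _ KF] spec[of _ KX] spec[of _ KP] spec[of _ KG] spec[of _ KY])+
  have w2: "w KH = 0"
    using fun_cong[OF even[of KE 1], of KE] laurent_double_cancel[of "w KH" 0]
    by (simp add: single_coord_def wron_def)
  have w3: "w KL = 0"
    using fun_cong[OF even[of KE "Poly_Mapping.single 1 1"], of KE]
    by (simp add: single_coord_def wron_def w2)
  have "w = 0" by (rule coords_eqI) (simp_all add: w1 w2 w3)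
  then have out: "outer \<alpha> m x = outer \<alpha> n x" for x using *[of x] by simp
  have inj: "const c = const d \<longleftrightarrow> c = d" for c d
    by (metis lookup_single_eq)
  have eq11: "m $ 1 $ 1 = n $ 1 $ 1"
    using fun_cong[OF out[of "single_coord KX 1"], of KX] by (simp add: outer_def single_coord_def inj)
  \<comment> \<open>The test function t^\<alpha> cancels \<open>tw_inv \<alpha>\<close> and leaves
    the bare matrix entry.\<close>
  have eq21: "m $ 2 $ 1 = n $ 2 $ 1" if "\<alpha> \<in> \<int>"
    using fun_cong[OF out[of "single_coord KX (tw \<alpha>)"], of KG] tw_deriv(3)[of \<alpha>] that
    by (simp add: outer_def single_coord_def inj mult.assoc mult.commute[of "tw_inv \<alpha>"])
  have eq12: "m $ 1 $ 2 = n $ 1 $ 2" if "\<alpha> \<in> \<int>"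
    using fun_cong[OF out[of "single_coord KG (tw_inv \<alpha>)"], of KX] tw_deriv(3)[of \<alpha>] that
    by (simp add: outer_def single_coord_def inj mult.assoc)
  have eq22: "m $ 2 $ 2 = n $ 2 $ 2"
    using eq11 assms(1,2) by (auto simp: outer_sl2_def trace_2 add_eq_0_iff)
  show ?thesis
    using eq11 eq12 eq21 eq22 assms(1,2)
    by (cases "\<alpha> \<in> \<int>") (auto simp: vec_eq_iff forall_2 outer_sl2_def)
qed

text \<open>The commutator of a semidirect product: a matrix m acts as an even derivation, so its
  commutator with the inner derivation of v is the inner derivation of m v.\<close>

lemma der_of_supercomm:
  assumes "m \<in> scarrier (outer_sl2 \<alpha>)" "n \<in> scarrier (outer_sl2 \<alpha>)"
  shows "supercomm (S2' \<alpha>) (der_of \<alpha> u m) (der_of \<alpha> v n) =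
    der_of \<alpha> (bracket \<alpha> u v + outer \<alpha> m v - outer \<alpha> n u) (m ** n - n ** m)"
proof -
  have m: "trace m = 0" "\<alpha> \<in> \<int> \<or> m $ 1 $ 2 = 0 \<and> m $ 2 $ 1 = 0"
    and n: "trace n = 0" "\<alpha> \<in> \<int> \<or> n $ 1 $ 2 = 0 \<and> n $ 2 $ 1 = 0"
    using assms by (auto simp: outer_sl2_def)
  have jac: "bracket \<alpha> (bracket \<alpha> (cpart p u) (cpart q v)) x =
      bracket \<alpha> (cpart p u) (bracket \<alpha> (cpart q v) x)
      - cscale (koszul p q) (bracket \<alpha> (cpart q v) (bracket \<alpha> (cpart p u) x))" for p q x
    using bracket_jacobi[of p "cpart p u" q "cpart q v" \<alpha> x] by simp
  have split: "bracket \<alpha> u x = bracket \<alpha> (cpart 0 u) x + bracket \<alpha> (cpart 1 u) x"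
     "bracket \<alpha> v x = bracket \<alpha> (cpart 0 v) x + bracket \<alpha> (cpart 1 v) x" for x
    by (simp_all flip: bracket_add(2))
  have koszul: "koszul 0 p = 1" "koszul p 0 = 1" "koszul 1 1 = - 1" for p
    by (simp_all add: koszul_def)
  have com: "outer \<alpha> (m ** n - n ** m) x = outer \<alpha> m (outer \<alpha> n x) - outer \<alpha> n (outer \<alpha> m x)" for x
    using outer_commutator[OF m(2) n(2)] by simp
  have uv: "bracket \<alpha> (bracket \<alpha> u v) x =
      bracket \<alpha> (bracket \<alpha> (cpart 0 u) (cpart 0 v)) x + bracket \<alpha> (bracket \<alpha> (cpart 0 u) (cpart 1 v)) x
      + (bracket \<alpha> (bracket \<alpha> (cpart 1 u) (cpart 0 v)) x + bracket \<alpha> (bracket \<alpha> (cpart 1 u) (cpart 1 v)) x)" for x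
    by (simp flip: bracket_add)
  show ?thesis
    unfolding supercomm_def Let_def der_of_part
    unfolding der_of_def lift_ops lift_inject
    by (rule ext, simp only: bracket_add bracket_diff uv com outer_linear outer_bracket[OF m(1)] outer_bracket[OF n(1)],
        simp add: jac koszul bracket_add bracket_diff outer_bracket[OF m(1)] outer_bracket[OF n(1)],
        simp add: split bracket_add algebra_simps, simp flip: bracket_add(2) outer_linear(1))
qed

section \<open>Exterior derivations as a Lie algebra of matrices\<close>

lemma outer_sl2_simps [simp]:
  "szero (outer_sl2 \<alpha>) = 0" "splus (outer_sl2 \<alpha>) = (+)"
  "sscale (outer_sl2 \<alpha>) = (\<lambda>c X. \<chi> i j. c * X $ i $ j)"
  "sprod (outer_sl2 \<alpha>) = (\<lambda>X Y. X ** Y - Y ** X)"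
  "spart (outer_sl2 \<alpha>) = (\<lambda>p X. if p = 0 then X else 0)"
  by (simp_all add: outer_sl2_def sl2_def)

lemma outer_sl2_carrier:
  "m \<in> scarrier (outer_sl2 \<alpha>) \<longleftrightarrow>
    m $ 2 $ 2 = - m $ 1 $ 1 \<and> (\<alpha> \<in> \<int> \<or> m $ 1 $ 2 = 0 \<and> m $ 2 $ 1 = 0)"
  by (auto simp: outer_sl2_def trace_2 add_eq_0_iff)

lemma Inn_S2': "Inn (S2' \<alpha>) = range (\<lambda>u. der_of \<alpha> u 0)"
proof -
  have "inner_der (S2' \<alpha>) (field \<alpha> u) = der_of \<alpha> u 0" for u
    unfolding der_of_def by (rule lift_eqI) (simp_all add: inner_der_def field_bracket)
  then show ?thesis by (simp add: Inn_def S2'_carrier image_image)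
qed

definition outer_class :: "complex \<Rightarrow> complex^2^2 \<Rightarrow> ((sfun \<Rightarrow> sfun) \<Rightarrow> sfun \<Rightarrow> sfun) set" where
  "outer_class \<alpha> m = ext_class (S2' \<alpha>) (der_of \<alpha> 0 m)"

lemma Der_S2'_simps:
  "splus (Der (S2' \<alpha>)) = op_plus (S2' \<alpha>)" "sscale (Der (S2' \<alpha>)) = op_scale (S2' \<alpha>)"
  "sprod (Der (S2' \<alpha>)) = supercomm (S2' \<alpha>)" "spart (Der (S2' \<alpha>)) = op_part (S2' \<alpha>)"
  "szero (Der (S2' \<alpha>)) = der_of \<alpha> 0 0"
proof -
  show "szero (Der (S2' \<alpha>)) = der_of \<alpha> 0 0"
    unfolding der_of_def by (rule lift_eqI) (simp_all add: Der_def)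
qed (simp_all add: Der_def)

text \<open>Modulo inner derivations \<open>der_of \<alpha> u m\<close> depends on m only, and the
  coset operations are those of matrices.\<close>

lemma outer_class_iso: "outer_class \<alpha> \<in> superalgebra_iso (outer_sl2 \<alpha>) (Der_ext (S2' \<alpha>))"
proof -
  have "(\<lambda>m. coset (Der (S2' \<alpha>)) (Inn (S2' \<alpha>)) (der_of \<alpha> 0 m))
      \<in> superalgebra_iso (outer_sl2 \<alpha>) (quotient (Der (S2' \<alpha>)) (Inn (S2' \<alpha>)))"
  proof (rule superalgebra_iso_quotient[where \<rho> = "der_of \<alpha>"])
    show "scarrier (Der (S2' \<alpha>)) = (\<Union>m\<in>scarrier (outer_sl2 \<alpha>). range (\<lambda>u. der_of \<alpha> u m))"
      by (rule Der_S2'_carrier)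
    show "\<exists>w. spart (Der (S2' \<alpha>)) p (der_of \<alpha> u m) = der_of \<alpha> w (spart (outer_sl2 \<alpha>) p m)" for p u m
      unfolding Der_S2'_simps der_of_part by auto
  qed (auto simp: Der_S2'_simps der_of_plus der_of_scale der_of_supercomm Inn_S2' der_of_inject,
      auto simp: outer_sl2_carrier matrix_matrix_mult_def sum_2)
  then show ?thesis
    by (simp add: outer_class_def[abs_def] ext_class_def Der_ext_def)
qed

lemma outer_class_zero: "szero (Der_ext (S2' \<alpha>)) = outer_class \<alpha> 0"
  by (simp add: Der_ext_def quotient_def outer_class_def ext_class_def Der_S2'_simps)

lemma outer_sl2_subspace: "ssubspace (outer_sl2 \<alpha>) (scarrier (outer_sl2 \<alpha>))"
  by (auto simp: ssubspace_def outer_sl2_carrier)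

lemma sl2_entries [simp]:
  "sl2_e $ 1 $ 1 = 0" "sl2_e $ 1 $ 2 = 1" "sl2_e $ 2 $ 1 = 0" "sl2_e $ 2 $ 2 = 0"
  "sl2_h $ 1 $ 1 = 1" "sl2_h $ 1 $ 2 = 0" "sl2_h $ 2 $ 1 = 0" "sl2_h $ 2 $ 2 = - 1"
  "sl2_f $ 1 $ 1 = 0" "sl2_f $ 1 $ 2 = 0" "sl2_f $ 2 $ 1 = 1" "sl2_f $ 2 $ 2 = 0"
  by (simp_all add: sl2_e_def sl2_h_def sl2_f_def)

lemma outer_sl2_span:
  assumes "G \<subseteq> scarrier (outer_sl2 \<alpha>)" "sl2_h \<in> G" "\<alpha> \<in> \<int> \<Longrightarrow> sl2_e \<in> G \<and> sl2_f \<in> G"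
  shows "scarrier (outer_sl2 \<alpha>) = sspan (outer_sl2 \<alpha>) G"
proof
  show "sspan (outer_sl2 \<alpha>) G \<subseteq> scarrier (outer_sl2 \<alpha>)"
    unfolding sspan_def using outer_sl2_subspace assms(1) by blast
  show "scarrier (outer_sl2 \<alpha>) \<subseteq> sspan (outer_sl2 \<alpha>) G"
    unfolding sspan_def
  proof (intro subsetI InterI, clarify)
    fix m V assume m: "m \<in> scarrier (outer_sl2 \<alpha>)" and V: "ssubspace (outer_sl2 \<alpha>) V" "G \<subseteq> V"
    let ?s = "\<lambda>c (X :: complex^2^2). \<chi> i j. c * X $ i $ j"
    have scale: "?s c x \<in> V" and plus: "x + y \<in> V" if "x \<in> V" "y \<in> V" for c x y
      using V(1) that by (auto simp: ssubspace_def)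
    have h: "?s (m $ 1 $ 1) sl2_h \<in> V" using scale assms(2) V(2) by blast
    show "m \<in> V"
    proof (cases "\<alpha> \<in> \<int>")
      case True
      then have "?s (m $ 1 $ 2) sl2_e \<in> V" "?s (m $ 2 $ 1) sl2_f \<in> V"
        using scale assms(3) V(2) by blast+
      with h have "?s (m $ 1 $ 1) sl2_h + (?s (m $ 1 $ 2) sl2_e + ?s (m $ 2 $ 1) sl2_f) \<in> V"
        by (intro plus)
      also have "?s (m $ 1 $ 1) sl2_h + (?s (m $ 1 $ 2) sl2_e + ?s (m $ 2 $ 1) sl2_f) = m"
        using m by (simp add: vec_eq_iff forall_2 outer_sl2_carrier)
      finally show ?thesis .
    next
      case False
      with m have "?s (m $ 1 $ 1) sl2_h = m"
        by (simp add: vec_eq_iff forall_2 outer_sl2_carrier)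
      with h show ?thesis by simp
    qed
  qed
qed

lemma sl2_mem:
  "sl2_h \<in> scarrier (outer_sl2 \<alpha>)"
  "\<alpha> \<in> \<int> \<Longrightarrow> sl2_e \<in> scarrier (outer_sl2 \<alpha>)" "\<alpha> \<in> \<int> \<Longrightarrow> sl2_f \<in> scarrier (outer_sl2 \<alpha>)"
  by (simp_all add: outer_sl2_carrier)

lemma der_of_field: "der_of \<alpha> 0 m (field \<alpha> u) = field \<alpha> (outer \<alpha> m u)"
  by (simp add: der_of_def)

text \<open>The index shifts arise because h_k and y_k have exponent k but x_k and p_k have exponent
  k + 1: multiplication by t^a takes h_k to x_{k-1+a}, and t^(-a) takes x_k to h_{k+1-a}.\<close>

lemma acts_der_of:
  "acts_as_H \<alpha> (der_of \<alpha> 0 sl2_h)"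
  "\<alpha> = of_int a \<Longrightarrow> acts_as_E a (der_of \<alpha> 0 sl2_e)"
  "\<alpha> = of_int a \<Longrightarrow> acts_as_F a (der_of \<alpha> 0 sl2_f)"
  unfolding acts_as_H_def acts_as_E_def acts_as_F_def Let_def
  by (auto simp: bas_coords[where \<alpha> = \<alpha>] bas_coords[where \<alpha> = "of_int a"] der_of_field field_sscale field_inject
      outer_def single_coord_def cscale_def tw_def tw_inv_def mult_single single_uminus algebra_simps
      intro!: coords_eqI)

theorem theorem4p1:
  fixes \<alpha> :: complex
  shows
    "(\<forall>a::int. \<alpha> = of_int a \<longrightarrow>
       (\<exists>E \<in> scarrier (Der (S2' \<alpha>)). \<exists>H \<in> scarrier (Der (S2' \<alpha>)). \<exists>F \<in> scarrier (Der (S2' \<alpha>)).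
          acts_as_E a E \<and> acts_as_H \<alpha> H \<and> acts_as_F a F \<and>
          (let X = Der_ext (S2' \<alpha>);
               cE = ext_class (S2' \<alpha>) E; cH = ext_class (S2' \<alpha>) H; cF = ext_class (S2' \<alpha>) F
           in (\<exists>\<phi> \<in> superalgebra_iso sl2 X. \<phi> sl2_e = cE \<and> \<phi> sl2_h = cH \<and> \<phi> sl2_f = cF) \<and>
              scarrier X = sspan X {cE, cH, cF} \<and>
              sprod X cH cE = sscale X 2 cE \<and>
              sprod X cH cF = sscale X (- 2) cF \<and>
              sprod X cE cF = cH)))
     \<and>
     (\<alpha> \<notin> \<int> \<longrightarrow>
       (\<exists>H \<in> scarrier (Der (S2' \<alpha>)).
          acts_as_H \<alpha> H \<and>
          ext_class (S2' \<alpha>) H \<noteq> szero (Der_ext (S2' \<alpha>)) \<and>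
          scarrier (Der_ext (S2' \<alpha>)) = sspan (Der_ext (S2' \<alpha>)) {ext_class (S2' \<alpha>) H}))"
proof (intro conjI allI impI)
  let ?X = "Der_ext (S2' \<alpha>)"
  have prod: "outer_class \<alpha> (m ** n - n ** m) = sprod ?X (outer_class \<alpha> m) (outer_class \<alpha> n)"
    if "m \<in> scarrier (outer_sl2 \<alpha>)" "n \<in> scarrier (outer_sl2 \<alpha>)" for m n
    using outer_class_iso[of \<alpha>] that by (auto simp: superalgebra_iso_def)
  have scale: "outer_class \<alpha> (\<chi> i j. c * m $ i $ j) = sscale ?X c (outer_class \<alpha> m)"
    if "m \<in> scarrier (outer_sl2 \<alpha>)" for c m
    using outer_class_iso[of \<alpha>] that by (auto simp: superalgebra_iso_def)
  have span: "scarrier ?X = sspan ?X (outer_class \<alpha> ` G)"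
    if "G \<subseteq> scarrier (outer_sl2 \<alpha>)" "sl2_h \<in> G" "\<alpha> \<in> \<int> \<Longrightarrow> sl2_e \<in> G \<and> sl2_f \<in> G" for G
    using outer_sl2_span[of G \<alpha>] that outer_class_zero
    by (intro sspan_superalgebra_iso[OF outer_class_iso _ outer_sl2_subspace]) auto
  {
    fix a :: int assume a: "\<alpha> = of_int a"
    then have Z: "\<alpha> \<in> \<int>" by simp
    note acts = acts_der_of(1)[of \<alpha>] acts_der_of(2,3)[OF a]
    note mem = sl2_mem(1)[of \<alpha>] sl2_mem(2,3)[OF Z]
    \<comment> \<open>For integral \<alpha> the condition on off-diagonal entries is vacuous, so
      \<open>outer_sl2 \<alpha>\<close> is \<open>sl2\<close> itself.\<close>
    have iso: "outer_class \<alpha> \<in> superalgebra_iso sl2 ?X"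
      using outer_class_iso[of \<alpha>] Z by (simp add: outer_sl2_def sl2_def)
    have rel: "sprod ?X (outer_class \<alpha> sl2_h) (outer_class \<alpha> sl2_e) = sscale ?X 2 (outer_class \<alpha> sl2_e)"
      "sprod ?X (outer_class \<alpha> sl2_h) (outer_class \<alpha> sl2_f) = sscale ?X (- 2) (outer_class \<alpha> sl2_f)"
      "sprod ?X (outer_class \<alpha> sl2_e) (outer_class \<alpha> sl2_f) = outer_class \<alpha> sl2_h"
      unfolding prod[OF mem(1,2), symmetric] prod[OF mem(1,3), symmetric] prod[OF mem(2,3), symmetric]
        scale[OF mem(2), symmetric] scale[OF mem(3), symmetric]
      by (rule arg_cong[where f = "outer_class \<alpha>"];
          simp add: vec_eq_iff forall_2 matrix_matrix_mult_def sum_2)+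
    have gen: "scarrier ?X = sspan ?X {outer_class \<alpha> sl2_e, outer_class \<alpha> sl2_h, outer_class \<alpha> sl2_f}"
      using span[of "{sl2_e, sl2_h, sl2_f}"] mem by simp
    show "\<exists>E \<in> scarrier (Der (S2' \<alpha>)). \<exists>H \<in> scarrier (Der (S2' \<alpha>)). \<exists>F \<in> scarrier (Der (S2' \<alpha>)).
          acts_as_E a E \<and> acts_as_H \<alpha> H \<and> acts_as_F a F \<and>
          (let X = Der_ext (S2' \<alpha>);
               cE = ext_class (S2' \<alpha>) E; cH = ext_class (S2' \<alpha>) H; cF = ext_class (S2' \<alpha>) F
           in (\<exists>\<phi> \<in> superalgebra_iso sl2 X. \<phi> sl2_e = cE \<and> \<phi> sl2_h = cH \<and> \<phi> sl2_f = cF) \<and>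
              scarrier X = sspan X {cE, cH, cF} \<and>
              sprod X cH cE = sscale X 2 cE \<and>
              sprod X cH cF = sscale X (- 2) cF \<and>
              sprod X cE cF = cH)"
      unfolding Let_def
    proof (rule bexI[where x = "der_of \<alpha> 0 sl2_e"], rule bexI[where x = "der_of \<alpha> 0 sl2_h"],
        rule bexI[where x = "der_of \<alpha> 0 sl2_f"], unfold outer_class_def[symmetric], intro conjI)
      show "\<exists>\<phi> \<in> superalgebra_iso sl2 ?X. \<phi> sl2_e = outer_class \<alpha> sl2_e \<and>
          \<phi> sl2_h = outer_class \<alpha> sl2_h \<and> \<phi> sl2_f = outer_class \<alpha> sl2_f"
        using iso by blast
    qed (rule rel gen acts der_of_mem[OF mem(1)] der_of_mem[OF mem(2)] der_of_mem[OF mem(3)])+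
  next
    assume Z: "\<alpha> \<notin> \<int>"
    have "sl2_h \<noteq> 0" by (metis sl2_entries(5) zero_index zero_neq_one)
    moreover have "inj_on (outer_class \<alpha>) (scarrier (outer_sl2 \<alpha>))"
      using outer_class_iso[of \<alpha>] by (auto simp: superalgebra_iso_def bij_betw_def)
    moreover have "0 \<in> scarrier (outer_sl2 \<alpha>)" by (simp add: outer_sl2_carrier)
    ultimately have "outer_class \<alpha> sl2_h \<noteq> szero ?X"
      using sl2_mem(1)[of \<alpha>] unfolding outer_class_zero by (auto dest: inj_onD)
    moreover have "scarrier ?X = sspan ?X {outer_class \<alpha> sl2_h}"
      using span[of "{sl2_h}"] sl2_mem(1)[of \<alpha>] Z by simp
    ultimately show "\<exists>H \<in> scarrier (Der (S2' \<alpha>)).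
          acts_as_H \<alpha> H \<and>
          ext_class (S2' \<alpha>) H \<noteq> szero (Der_ext (S2' \<alpha>)) \<and>
          scarrier (Der_ext (S2' \<alpha>)) = sspan (Der_ext (S2' \<alpha>)) {ext_class (S2' \<alpha>) H}"
      using acts_der_of(1)[of \<alpha>] der_of_mem[OF sl2_mem(1)]
      by (intro bexI[where x = "der_of \<alpha> 0 sl2_h"]) (auto simp: outer_class_def)
  }
qed

end
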